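(* Assume that $0<\alpha<1$. Let $A\in\mathbb{M}_n^+$ be given with the spectral decomposition $A=\sum_{k=1}^m a_kP_k$ where $a_1>\dots>a_m>0$, and let $E\in\mathbb{M}_n$ be an orthogonal projection. Then $$\lim_{p\to\infty}(A^p\,\#_\alpha\,E)^{1/p}=\sum_{k=1}^m a_k^{1-\alpha}Q_k,$$ where $$Q_1:=P_1\wedge E,\qquad Q_k:=(P_1+\dots+P_k)\wedge E-(P_1+\dots+P_{k-1})\wedge E,\quad 2\le k\le m.$$
   Context: $\mathbb{M}_n$ is the algebra of $n\times n$ complex matrices and $\mathbb{M}_n^+$ the set of positive semidefinite matrices in $\mathbb{M}_n$. In the spectral decomposition, $a_1,\dots,a_m$ are the distinct positive eigenvalues of $A$ and $P_k$ is the orthogonal projection onto the eigenspace of $a_k$ (the $P_k$ sum to the support projection of $A$, not necessarily to $I$). The weighted geometric mean $\#_\alpha$ is defined by $A\,\#_\alpha\,B:=A^{1/2}(A^{-1/2}BA^{-1/2})^\alpha A^{1/2}$ for $A,B\in\mathbb{M}_n^+$ with $A$ positive definite, and extended to general $A,B\in\mathbb{M}_n^+$ by $A\,\#_\alpha\,B:=\lim_{\varepsilon\searrow0}(A+\varepsilon I)\,\#_\alpha\,(B+\varepsilon I)$. For orthogonal projections $P,E$, $P\wedge E$ is the orthogonal projection onto $\mathrm{ran}\,P\cap\mathrm{ran}\,E$. Powers $X^p$ with $p>0$ of positive semidefinite matrices are defined by functional calculus. The limit is over real $p\to\infty$. *)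

theory Defs
  imports "HOL-Analysis.Analysis"
begin

definition adjoint_matrix :: "complex^'n^'n \<Rightarrow> complex^'n^'n" where
  "adjoint_matrix A = (\<chi> i j. cnj (A $ j $ i))"

definition hermitian :: "complex^'n^'n \<Rightarrow> bool" where
  "hermitian A \<longleftrightarrow> adjoint_matrix A = A"

text \<open>The library's inner product on \<open>complex^'n\<close> is the real part of the Hermitian one;
  for Hermitian \<open>A\<close> the form \<open>\<langle>x, A x\<rangle>\<close> is real, so nothing is lost below.\<close>

definition pos_semidef :: "complex^'n^'n \<Rightarrow> bool" where
  "pos_semidef A \<longleftrightarrow> hermitian A \<and> (\<forall>x. 0 \<le> x \<bullet> (A *v x))"

definition pos_def :: "complex^'n^'n \<Rightarrow> bool" where
  "pos_def A \<longleftrightarrow> hermitian A \<and> (\<forall>x. x \<noteq> 0 \<longrightarrow> 0 < x \<bullet> (A *v x))"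

definition orth_projection :: "complex^'n^'n \<Rightarrow> bool" where
  "orth_projection P \<longleftrightarrow> hermitian P \<and> P ** P = P"

definition mat_ran :: "complex^'n^'n \<Rightarrow> (complex^'n) set" where
  "mat_ran A = range (\<lambda>x. A *v x)"

text \<open>Meaningful for complex-linear subspaces \<open>S\<close>.\<close>

definition proj_onto :: "(complex^'n) set \<Rightarrow> complex^'n^'n" where
  "proj_onto S = (THE P. orth_projection P \<and> mat_ran P = S)"

definition proj_meet :: "complex^'n^'n \<Rightarrow> complex^'n^'n \<Rightarrow> complex^'n^'n"
    (infixl "\<sqinter>\<^sub>p" 70) where
  "P \<sqinter>\<^sub>p E = proj_onto (mat_ran P \<inter> mat_ran E)"

text \<open>Eigenvalues are taken to be real: the notions below are only used for Hermitian matrices,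
  all of whose eigenvalues are real.\<close>

definition eigenspace :: "complex^'n^'n \<Rightarrow> real \<Rightarrow> (complex^'n) set" where
  "eigenspace A t = {x. A *v x = t *\<^sub>R x}"

definition eigenvalues :: "complex^'n^'n \<Rightarrow> real set" where
  "eigenvalues A = {t. \<exists>x. x \<noteq> 0 \<and> A *v x = t *\<^sub>R x}"

definition fun_calc :: "(real \<Rightarrow> real) \<Rightarrow> complex^'n^'n \<Rightarrow> complex^'n^'n" where
  "fun_calc f A = (\<Sum>t\<in>eigenvalues A. f t *\<^sub>R proj_onto (eigenspace A t))"

text \<open>Used with \<open>p > 0\<close> for positive semidefinite \<open>A\<close> (note \<open>0 powr p = 0\<close>), and with
  \<open>p < 0\<close> only for positive definite \<open>A\<close>.\<close>

definition mat_powr :: "complex^'n^'n \<Rightarrow> real \<Rightarrow> complex^'n^'n" where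
  "mat_powr A p = fun_calc (\<lambda>t. t powr p) A"

definition geo_mean_pd :: "real \<Rightarrow> complex^'n^'n \<Rightarrow> complex^'n^'n \<Rightarrow> complex^'n^'n" where
  "geo_mean_pd \<alpha> A B =
     mat_powr A (1/2) ** mat_powr (mat_powr A (-1/2) ** B ** mat_powr A (-1/2)) \<alpha>
       ** mat_powr A (1/2)"

definition geo_mean :: "real \<Rightarrow> complex^'n^'n \<Rightarrow> complex^'n^'n \<Rightarrow> complex^'n^'n" where
  "geo_mean \<alpha> A B =
     (if pos_def A then geo_mean_pd \<alpha> A B
      else Lim (at_right 0) (\<lambda>\<epsilon>::real. geo_mean_pd \<alpha> (A + \<epsilon> *\<^sub>R mat 1) (B + \<epsilon> *\<^sub>R mat 1)))"

text \<open>\<open>A = \<Sum>k=1..m. a k P k\<close> where \<open>a 1 > \<dots> > a m > 0\<close> are all the positive eigenvalues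
  of \<open>A\<close>; the kernel of \<open>A\<close> does not contribute, and \<open>m = 0\<close> is the case \<open>A = 0\<close>.\<close>

definition spectral_decomposition ::
    "complex^'n^'n \<Rightarrow> nat \<Rightarrow> (nat \<Rightarrow> real) \<Rightarrow> (nat \<Rightarrow> complex^'n^'n) \<Rightarrow> bool" where
  "spectral_decomposition A m a P \<longleftrightarrow>
     A = (\<Sum>k=1..m. a k *\<^sub>R P k) \<and>
     (\<forall>i j. 1 \<le> i \<and> i < j \<and> j \<le> m \<longrightarrow> a j < a i) \<and>
     a ` {1..m} = {t \<in> eigenvalues A. 0 < t} \<and>
     (\<forall>k\<in>{1..m}. P k = proj_onto (eigenspace A (a k)))"

end

theory Submission
  imports Defs
begin

text \<open>
  Write \<open>R\<^sub>k = (P\<^sub>1 + \<dots> + P\<^sub>k) \<sqinter>\<^sub>p E\<close>, so that \<open>Q\<^sub>k = R\<^sub>k - R\<^sub>k\<^sub>-\<^sub>1\<close> with \<open>R\<^sub>0 = 0\<close>, and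
  \<open>G\<^sub>p\<close> for the mean of \<open>A\<^sup>p\<close> and \<open>E\<close>. The limit \<open>D = \<Sum>k. a\<^sub>k\<^sup>1\<^sup>-\<^sup>\<alpha> Q\<^sub>k\<close> satisfies
  \<open>(\<Sum>k. a\<^sub>k\<^sup>p\<^sup>(\<^sup>1\<^sup>-\<^sup>\<alpha>\<^sup>) Q\<^sub>k)\<^sup>1\<^sup>/\<^sup>p = D\<close> because the \<open>Q\<^sub>k\<close> are orthogonal projections with mutually orthogonal
  ranges. Put \<open>H\<^sub>p = \<Sum>k. a\<^sub>k\<^sup>p\<^sup>(\<^sup>1\<^sup>-\<^sup>\<alpha>\<^sup>) Q\<^sub>k\<close>. The proof is a sandwich in the Loewner order,

    \<open>c H\<^sub>p \<le> G\<^sub>p \<le> K H\<^sub>p\<close> with constants \<open>c, K > 0\<close> independent of \<open>p\<close>.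

  The function \<open>t \<mapsto> t\<^sup>1\<^sup>/\<^sup>p\<close> is operator monotone for \<open>p \<ge> 1\<close> (Loewner-Heinz), so
  \<open>c\<^sup>1\<^sup>/\<^sup>p D \<le> G\<^sub>p\<^sup>1\<^sup>/\<^sup>p \<le> K\<^sup>1\<^sup>/\<^sup>p D\<close>, and both factors tend to 1
  (\<open>tendsto_mat_powr_inverse_of_sandwich\<close>).

  Lower bound. Both \<open>A\<^sup>p \<ge> a\<^sub>k\<^sup>p R\<^sub>k\<close> and \<open>E \<ge> R\<^sub>k\<close>, whence \<open>G\<^sub>p \<ge> a\<^sub>k\<^sup>p\<^sup>(\<^sup>1\<^sup>-\<^sup>\<alpha>\<^sup>) R\<^sub>k \<ge> a\<^sub>k\<^sup>p\<^sup>(\<^sup>1\<^sup>-\<^sup>\<alpha>\<^sup>) Q\<^sub>k\<close>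
  by monotonicity of the mean (\<open>geo_mean_ge_projection\<close>); averaging over \<open>k\<close> gives \<open>c\<close>.

  Upper bound. A vector of \<open>ran Q\<^sub>k\<close> is orthogonal to
  \<open>ran R\<^sub>k\<^sub>-\<^sub>1 = ran (P\<^sub>1 + \<dots> + P\<^sub>k\<^sub>-\<^sub>1) \<inter> ran E\<close>, so it is a sum \<open>x + y\<close> with \<open>x\<close> in the kernel of
  \<open>P\<^sub>1 + \<dots> + P\<^sub>k\<^sub>-\<^sub>1\<close>, \<open>y\<close> in the kernel of \<open>E\<close>, and \<open>x\<close> of controlled norm
  (\<open>kernels_decomposition_bounded\<close>). The weighted arithmetic-geometric inequality
  \<open>geo_mean_le_arith\<close>, with its free scaling parameter, makes the form of \<open>G\<^sub>p\<close> vanish at \<open>y\<close> and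
  bounds it at \<open>x\<close> by \<open>a\<^sub>k\<^sup>p\<^sup>(\<^sup>1\<^sup>-\<^sup>\<alpha>\<^sup>) |x|\<^sup>2\<close> (\<open>geo_mean_form_le\<close>). On the orthogonal
  complement of \<open>ran R\<^sub>m\<close> the same argument, with \<open>x\<close> in the kernel of \<open>A\<close>, gives zero.

  When \<open>A\<^sup>p\<close> is singular the mean is a limit, whose existence must be proved: the regularised means
  decrease with \<open>\<epsilon>\<close> by joint monotonicity, which rests on Loewner-Heinz in one argument and on the
  symmetry \<open>geo_mean_pd_commute\<close> in the other. All estimates are statements about the quadratic forms
  \<open>x \<bullet> (M *v x)\<close>, which determine a Hermitian matrix and its limits by polarisation.
\<close>

section \<open>Hermitian matrices as self-adjoint operators\<close>

lemma scaleR_eq_of_real_smult: "r *\<^sub>R (x::complex^'n) = of_real r *s x"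
  by (simp add: vec_eq_iff scaleR_conv_of_real[where 'a=complex])

lemma matrix_vector_mult_scaleR_right:
  "(M::complex^'n^'n) *v (r *\<^sub>R x) = r *\<^sub>R (M *v x)"
  unfolding scaleR_eq_of_real_smult by (rule vec.scale)

lemma matrix_vector_mult_scaleR_left:
  "(r *\<^sub>R (M::complex^'n^'n)) *v x = r *\<^sub>R (M *v x)"
  by (simp add: matrix_vector_mult_def vec_eq_iff scaleR_sum_right)

lemma matrix_vector_mult_sum_left:
  "(\<Sum>k\<in>S. (M k::complex^'n^'n)) *v x = (\<Sum>k\<in>S. M k *v x)"
  by (induction S rule: infinite_finite_induct) (auto simp: matrix_vector_mult_add_rdistrib)

lemmas matrix_vector_linear_simps =
  matrix_vector_right_distrib matrix_vector_mult_diff_distrib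
  matrix_vector_mult_add_rdistrib matrix_vector_mult_diff_rdistrib
  matrix_vector_mult_scaleR_right matrix_vector_mult_scaleR_left
  matrix_vector_mult_sum_left

lemma linear_matrix_vector_mult: "linear ((*v) (M::complex^'n^'n))"
  by (rule linearI) (simp_all add: matrix_vector_linear_simps)

lemma inner_smult_left: "(c *s x) \<bullet> y = x \<bullet> (cnj c *s (y::complex^'n))"
  by (simp add: inner_vec_def inner_complex_def algebra_simps)

lemma inner_complex_mult_left: "(cnj a * b) \<bullet> c = b \<bullet> (a * c)"
  by (simp add: inner_complex_def algebra_simps)

lemma adjoint_matrix_inner: "(adjoint_matrix M *v x) \<bullet> y = x \<bullet> (M *v y)"
proof -
  have "(adjoint_matrix M *v x) \<bullet> y = (\<Sum>i\<in>UNIV. \<Sum>j\<in>UNIV. (cnj (M$j$i) * x$j) \<bullet> (y$i))"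
    by (simp add: inner_vec_def matrix_vector_mult_def adjoint_matrix_def inner_sum_left)
  also have "\<dots> = (\<Sum>j\<in>UNIV. \<Sum>i\<in>UNIV. (cnj (M$j$i) * x$j) \<bullet> (y$i))"
    by (rule sum.swap)
  also have "\<dots> = x \<bullet> (M *v y)"
    by (simp add: inner_vec_def matrix_vector_mult_def inner_sum_right inner_complex_mult_left)
  finally show ?thesis .
qed

text \<open>Although the real inner product is only the real part of the Hermitian one, self-adjointness for
  it already forces a complex-linear operator to be Hermitian, so real Euclidean geometry
  suffices throughout.\<close>

lemma hermitian_iff_selfadjoint:
  "hermitian M \<longleftrightarrow> (\<forall>x y. (M *v x) \<bullet> y = x \<bullet> (M *v y))"
proof
  assume "hermitian M"
  then show "\<forall>x y. (M *v x) \<bullet> y = x \<bullet> (M *v y)"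
    using adjoint_matrix_inner[of M] by (simp add: hermitian_def)
next
  assume sa: "\<forall>x y. (M *v x) \<bullet> y = x \<bullet> (M *v y)"
  have "adjoint_matrix M *v x = M *v x" for x
  proof -
    have "\<forall>y. (adjoint_matrix M *v x) \<bullet> y = (M *v x) \<bullet> y"
      using sa by (simp add: adjoint_matrix_inner)
    then show ?thesis by (simp add: vector_eq_rdot)
  qed
  then show "hermitian M" by (simp add: hermitian_def matrix_eq)
qed

lemma hermitian_inner: "hermitian M \<Longrightarrow> (M *v x) \<bullet> y = x \<bullet> (M *v y)"
  by (simp add: hermitian_iff_selfadjoint)

lemma hermitian_mat_1: "hermitian (mat 1)"
  by (simp add: hermitian_iff_selfadjoint)

lemma hermitian_add: "hermitian M \<Longrightarrow> hermitian N \<Longrightarrow> hermitian (M + N)"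
  by (simp add: hermitian_iff_selfadjoint matrix_vector_linear_simps inner_add)

lemma hermitian_diff: "hermitian M \<Longrightarrow> hermitian N \<Longrightarrow> hermitian (M - N)"
  by (simp add: hermitian_iff_selfadjoint matrix_vector_linear_simps inner_diff)

lemma hermitian_scaleR: "hermitian M \<Longrightarrow> hermitian (r *\<^sub>R M)"
  by (simp add: hermitian_iff_selfadjoint matrix_vector_linear_simps)

lemma hermitian_sum: "(\<And>k. k \<in> S \<Longrightarrow> hermitian (M k)) \<Longrightarrow> hermitian (\<Sum>k\<in>S. M k)"
  by (simp add: hermitian_iff_selfadjoint matrix_vector_linear_simps inner_sum_left inner_sum_right)

lemma hermitian_congruence: "hermitian S \<Longrightarrow> hermitian M \<Longrightarrow> hermitian (S ** M ** S)"
  by (simp add: hermitian_iff_selfadjoint flip: matrix_vector_mul_assoc)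

section \<open>Spectral theorem and functional calculus\<close>

text \<open>First-order condition for a minimum at \<open>t = 0\<close>, in the form used to show that a
  maximiser of the Rayleigh quotient is an eigenvector.\<close>

lemma affine_plus_square_nonneg_imp_0:
  fixes b c :: real
  assumes "\<And>t. 0 \<le> 2 * t * b + t\<^sup>2 * c" and "0 \<le> c"
  shows "b = 0"
proof -
  define u where "u = b / (c + 1)"
  have b: "b = u * (c + 1)" using assms(2) by (simp add: u_def)
  have "0 \<le> 2 * (-u) * b + (-u)\<^sup>2 * c" by (rule assms(1))
  also have "\<dots> = - (u\<^sup>2 * (c + 2))"
    unfolding b by (simp add: power2_eq_square algebra_simps)
  finally have "u\<^sup>2 * (c + 2) \<le> 0" by simp
  with assms(2) show ?thesis by (simp add: b mult_le_0_iff)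
qed

text \<open>The maximiser \<open>x\<close> of \<open>x \<bullet> (M *v x)\<close> on the unit sphere of the
  subspace works: the form of \<open>t - M\<close> is nonnegative there and vanishes at
  \<open>x\<close>, so varying \<open>x\<close> in the direction of the residual \<open>t x - M
  x\<close> shows that the residual is zero.\<close>

lemma hermitian_eigenvector_in_invariant_subspace:
  fixes M :: "complex^'n^'n"
  assumes herm: "hermitian M" and T: "subspace T" and nz: "x0 \<in> T" "x0 \<noteq> 0"
    and inv: "\<And>x. x \<in> T \<Longrightarrow> M *v x \<in> T"
  obtains x t where "x \<in> T" "x \<noteq> 0" "M *v x = t *\<^sub>R x"
proof -
  let ?S = "sphere 0 1 \<inter> T"
  have "compact ?S"
    by (intro compact_Int_closed compact_sphere closed_subspace T)
  moreover have "x0 /\<^sub>R norm x0 \<in> ?S"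
    using nz T by (simp add: subspace_scale)
  moreover have "continuous_on ?S (\<lambda>x. x \<bullet> (M *v x))"
    by (intro continuous_intros linear_continuous_on linear_conv_bounded_linear[THEN iffD1]
        linear_matrix_vector_mult)
  ultimately obtain x where x: "x \<in> ?S" and max: "\<And>y. y \<in> ?S \<Longrightarrow> y \<bullet> (M *v y) \<le> x \<bullet> (M *v x)"
    using continuous_attains_sup[of ?S "\<lambda>x. x \<bullet> (M *v x)"] by blast
  define t where "t = x \<bullet> (M *v x)"
  have xx: "x \<bullet> x = 1" using x by (simp add: dot_square_norm)
  have bound: "y \<bullet> (M *v y) \<le> t * (y \<bullet> y)" if "y \<in> T" for y
  proof (cases "y = 0")
    case False
    have "(y /\<^sub>R norm y) \<bullet> (M *v (y /\<^sub>R norm y)) \<le> t"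
      unfolding t_def using that False T by (intro max) (simp add: subspace_scale)
    then have "(y \<bullet> (M *v y)) / (norm y)\<^sup>2 \<le> t"
      by (simp add: matrix_vector_linear_simps power2_eq_square field_simps)
    then show ?thesis
      using False by (simp add: field_simps dot_square_norm)
  qed simp
  define r where "r = t *\<^sub>R x - M *v x"
  have rT: "r \<in> T" unfolding r_def using x inv T by (auto intro: subspace_diff subspace_scale)
  have "r \<bullet> r = 0"
  proof (rule affine_plus_square_nonneg_imp_0)
    show "0 \<le> t * (r \<bullet> r) - r \<bullet> (M *v r)" using bound[OF rT] by simp
    fix s :: real
    have "x + s *\<^sub>R r \<in> T" using x rT T by (auto intro: subspace_add subspace_scale)
    from bound[OF this]
    have "0 \<le> t * ((x + s *\<^sub>R r) \<bullet> (x + s *\<^sub>R r)) - (x + s *\<^sub>R r) \<bullet> (M *v (x + s *\<^sub>R r))" by simp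
    also have "\<dots> = 2 * s * (t * (x \<bullet> r) - (M *v x) \<bullet> r) + s\<^sup>2 * (t * (r \<bullet> r) - r \<bullet> (M *v r))"
    proof -
      have "(x + s *\<^sub>R r) \<bullet> (x + s *\<^sub>R r) = 1 + 2 * s * (x \<bullet> r) + s\<^sup>2 * (r \<bullet> r)"
        using xx by (simp add: inner_add inner_commute[of r x] power2_eq_square distrib_left)
      moreover have "(x + s *\<^sub>R r) \<bullet> (M *v (x + s *\<^sub>R r))
          = t + 2 * s * ((M *v x) \<bullet> r) + s\<^sup>2 * (r \<bullet> (M *v r))"
        using hermitian_inner[OF herm, of x r]
        by (simp add: matrix_vector_linear_simps inner_add inner_commute[of r "M *v x"] power2_eq_square
            t_def distrib_left)
      ultimately show ?thesis by (simp only:) (simp add: algebra_simps)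
    qed
    also have "t * (x \<bullet> r) - (M *v x) \<bullet> r = r \<bullet> r"
      unfolding r_def using hermitian_inner[OF herm, of x x] by (simp add: inner_diff algebra_simps)
    finally show "0 \<le> 2 * s * (r \<bullet> r) + s\<^sup>2 * (t * (r \<bullet> r) - r \<bullet> (M *v r))" .
  qed
  then have "M *v x = t *\<^sub>R x" by (simp add: r_def)
  moreover have "x \<noteq> 0" using xx by auto
  ultimately show thesis using that x by blast
qed

text \<open>The spectral theorem: the orthogonal complement of the span of all eigenvectors is invariant, so
  if it were nonzero it would contain a further eigenvector.\<close>

lemma span_eigenvectors:
  assumes herm: "hermitian M"
  shows "span {x. \<exists>t. M *v x = t *\<^sub>R x} = UNIV"
proof -
  let ?W = "span {x. \<exists>t. M *v x = t *\<^sub>R x}"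
  have inv: "M *v x \<in> ?W" if "x \<in> ?W" for x
    using that
  proof (induction rule: span_induct_alt)
    case (step c x y)
    then obtain t where "M *v x = t *\<^sub>R x" by blast
    then have "M *v (c *\<^sub>R x + y) = (c * t) *\<^sub>R x + M *v y"
      by (simp add: matrix_vector_linear_simps)
    moreover have "x \<in> ?W" using step by (intro span_base) auto
    ultimately show ?case using step by (simp add: span_add span_scale)
  qed (simp add: span_zero)
  have "?W\<^sup>\<bottom> = {0}"
  proof (rule ccontr)
    assume "?W\<^sup>\<bottom> \<noteq> {0}"
    then obtain x0 where "x0 \<in> ?W\<^sup>\<bottom>" "x0 \<noteq> 0"
      using subspace_0[OF subspace_orthogonal_comp] by blast
    moreover have "M *v x \<in> ?W\<^sup>\<bottom>" if "x \<in> ?W\<^sup>\<bottom>" for x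
      unfolding orthogonal_comp_def orthogonal_def
    proof safe
      fix y assume "y \<in> ?W"
      then have "(M *v y) \<bullet> x = 0"
        using that inv by (simp only: orthogonal_comp_def orthogonal_def mem_Collect_eq)
      then show "y \<bullet> (M *v x) = 0" by (simp add: hermitian_inner[OF herm])
    qed
    ultimately obtain x t where x: "x \<in> ?W\<^sup>\<bottom>" "x \<noteq> 0" "M *v x = t *\<^sub>R x"
      by (rule hermitian_eigenvector_in_invariant_subspace[OF herm subspace_orthogonal_comp])
    then have "x \<in> ?W" by (auto intro: span_base)
    with x show False by (auto simp: orthogonal_comp_def orthogonal_def)
  qed
  have "?W = ?W\<^sup>\<bottom>\<^sup>\<bottom>" by (rule orthogonal_comp_self[OF subspace_span, symmetric])
  also have "\<dots> = UNIV" unfolding \<open>?W\<^sup>\<bottom> = {0}\<close> by (rule orthogonal_comp_null)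
  finally show ?thesis .
qed

text \<open>The workhorse for all identities of the functional calculus: it is enough to compare two
  matrices on the eigenvectors of one Hermitian matrix.\<close>

lemma matrix_eq_on_eigenvectors:
  fixes M K L :: "complex^'n^'n"
  assumes "hermitian M" and "\<And>t x. M *v x = t *\<^sub>R x \<Longrightarrow> K *v x = L *v x"
  shows "K = L"
proof -
  have "K *v x = L *v x" for x
    by (rule linear_eq_on_span[where B = "{x. \<exists>t. M *v x = t *\<^sub>R x}"])
      (use assms in \<open>auto simp: linear_matrix_vector_mult span_eigenvectors\<close>)
  then show ?thesis by (simp add: matrix_eq)
qed

subsection \<open>Orthogonal projections\<close>

lemma orth_projection_idem: "orth_projection P \<Longrightarrow> P *v (P *v x) = P *v x"
  by (simp add: orth_projection_def matrix_vector_mul_assoc)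

lemma orth_projection_mem_ran:
  assumes "orth_projection P"
  shows "x \<in> mat_ran P \<longleftrightarrow> P *v x = x"
proof
  assume "x \<in> mat_ran P"
  then obtain y where "x = P *v y" by (auto simp: mat_ran_def)
  then show "P *v x = x" using orth_projection_idem[OF assms] by simp
next
  assume "P *v x = x"
  then show "x \<in> mat_ran P" unfolding mat_ran_def by (metis rangeI)
qed

lemma orth_projection_inner: "orth_projection P \<Longrightarrow> (P *v x) \<bullet> y = x \<bullet> (P *v y)"
  by (simp add: orth_projection_def hermitian_inner)

lemma orth_projection_form: "orth_projection P \<Longrightarrow> x \<bullet> (P *v x) = (norm (P *v x))\<^sup>2"
  using orth_projection_inner[of P x "P *v x"] by (simp add: orth_projection_idem dot_square_norm)

lemma orth_projection_absorb_commute: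
  assumes "orth_projection P" "orth_projection P'" and "\<And>x. P' *v (P *v x) = P *v x"
  shows "P *v (P' *v x) = P *v x"
proof -
  have "\<forall>y. (P *v (P' *v x)) \<bullet> y = (P *v x) \<bullet> y"
    by (simp add: orth_projection_inner assms)
  then show ?thesis by (simp only: vector_eq_rdot)
qed

lemma orth_projection_unique:
  assumes P: "orth_projection P" and P': "orth_projection P'" and ran: "mat_ran P = mat_ran P'"
  shows "P = P'"
proof -
  have 1: "P' *v (P *v x) = P *v x" for x
    unfolding orth_projection_mem_ran[OF P', symmetric] ran[symmetric] by (simp add: mat_ran_def)
  have 2: "P *v (P' *v x) = P' *v x" for x
    unfolding orth_projection_mem_ran[OF P, symmetric] ran by (simp add: mat_ran_def)
  have "P *v x = P' *v x" for x
    by (rule trans[OF orth_projection_absorb_commute[OF P P' 1, symmetric] 2])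
  then show ?thesis by (simp add: matrix_eq)
qed

lemma complex_subspace_imp_subspace:
  fixes S :: "(complex^'n) set"
  shows "vec.subspace S \<Longrightarrow> subspace S"
  by (auto simp: subspace_def vec.subspace_def scaleR_eq_of_real_smult)

text \<open>The real orthogonal projection onto a complex-linear subspace is complex linear, because the
  orthogonality of the residual to the subspace is preserved by complex scalars; it is therefore
  given by a complex matrix.\<close>

lemma orth_projection_onto_exists:
  fixes S :: "(complex^'n) set"
  assumes S: "vec.subspace S"
  shows "\<exists>P. orth_projection P \<and> mat_ran P = S"
proof -
  have rS: "subspace S" by (rule complex_subspace_imp_subspace[OF S])
  have "\<exists>y\<in>S. \<forall>w\<in>S. (x - y) \<bullet> w = 0" for x
  proof -
    obtain y z where yz: "y \<in> S" "\<And>w. w \<in> S \<Longrightarrow> orthogonal z w" "x = y + z"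
      using orthogonal_subspace_decomp_exists[of S x] span_eq_iff[THEN iffD2, OF rS] by auto
    then have "\<forall>w\<in>S. (x - y) \<bullet> w = 0" by (simp add: orthogonal_def)
    with yz(1) show ?thesis by blast
  qed
  then obtain g where gS: "\<And>x. g x \<in> S" and go: "\<And>x w. w \<in> S \<Longrightarrow> (x - g x) \<bullet> w = 0"
    by metis
  have uniq: "g x = y" if "y \<in> S" "\<And>w. w \<in> S \<Longrightarrow> (x - y) \<bullet> w = 0" for x y
  proof -
    have "g x - y \<in> S" using gS that(1) rS by (auto intro: subspace_diff)
    then have "(x - y) \<bullet> (g x - y) - (x - g x) \<bullet> (g x - y) = 0" using that(2) go by simp
    then have "(g x - y) \<bullet> (g x - y) = 0" by (simp add: inner_diff)
    then show ?thesis by simp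
  qed
  have add: "g (x + y) = g x + g y" for x y
  proof (rule uniq)
    show "g x + g y \<in> S" using gS rS by (auto intro: subspace_add)
    show "(x + y - (g x + g y)) \<bullet> w = 0" if "w \<in> S" for w
      using go[OF that, of x] go[OF that, of y] by (simp add: inner_diff inner_add)
  qed
  have scale: "g (c *s x) = c *s g x" for c x
  proof (rule uniq)
    show "c *s g x \<in> S" using gS S by (simp add: vec.subspace_scale)
    show "(c *s x - c *s g x) \<bullet> w = 0" if "w \<in> S" for w
    proof -
      have "cnj c *s w \<in> S" using S that by (simp add: vec.subspace_scale)
      then have "(c *s (x - g x)) \<bullet> w = 0" by (simp only: go inner_smult_left)
      then show ?thesis by (simp only: vec.scale_right_diff_distrib)
    qed
  qed
  have "Vector_Spaces.linear (*s) (*s) g"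
    by unfold_locales (simp_all add: add scale)
  then have G: "matrix g *v x = g x" for x by (rule matrix_works)
  have gid: "g x = x" if "x \<in> S" for x using that by (intro uniq) auto
  have "hermitian (matrix g)"
    unfolding hermitian_iff_selfadjoint G
  proof (intro allI)
    fix x y
    show "g x \<bullet> y = x \<bullet> g y"
      using go[OF gS, of y x] go[OF gS, of x y] by (simp add: inner_diff inner_commute)
  qed
  moreover have "matrix g ** matrix g = matrix g"
    by (simp add: matrix_eq G gid gS flip: matrix_vector_mul_assoc)
  moreover have "mat_ran (matrix g) = S"
  proof
    show "mat_ran (matrix g) \<subseteq> S" unfolding mat_ran_def using gS by (auto simp: G)
    show "S \<subseteq> mat_ran (matrix g)"
    proof
      fix x assume "x \<in> S"
      then have "x = matrix g *v x" using gid by (simp add: G)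
      then show "x \<in> mat_ran (matrix g)" unfolding mat_ran_def by (rule range_eqI)
    qed
  qed
  ultimately show ?thesis unfolding orth_projection_def by blast
qed

lemma proj_onto:
  fixes S :: "(complex^'n) set"
  assumes "vec.subspace S"
  shows orth_projection_proj_onto: "orth_projection (proj_onto S)"
    and mat_ran_proj_onto: "mat_ran (proj_onto S) = S"
proof -
  have "\<exists>!P. orth_projection P \<and> mat_ran P = S"
    using orth_projection_onto_exists[OF assms] orth_projection_unique by blast
  from theI'[OF this]
  show "orth_projection (proj_onto S)" "mat_ran (proj_onto S) = S"
    by (simp_all add: proj_onto_def)
qed

lemma complex_subspace_mat_ran: "vec.subspace (mat_ran M)"
  unfolding mat_ran_def by (rule vec.subspace_image[OF vec.subspace_UNIV])

lemma complex_subspace_eigenspace: "vec.subspace (eigenspace M t)"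
  unfolding vec.subspace_def eigenspace_def
  by (simp add: matrix_vector_linear_simps vec.scale scaleR_eq_of_real_smult
      vec.scale_right_distrib vec.scale_left_commute)

subsection \<open>Functional calculus\<close>

lemma eigenvectors_orthogonal:
  assumes "hermitian M" "M *v x = s *\<^sub>R x" "M *v y = t *\<^sub>R y" "s \<noteq> t"
  shows "x \<bullet> y = 0"
proof -
  have "s * (x \<bullet> y) = t * (x \<bullet> y)"
    using hermitian_inner[OF assms(1), of x y] assms by simp
  with assms(4) show ?thesis by simp
qed

lemma finite_eigenvalues:
  fixes M :: "complex^'n^'n"
  assumes herm: "hermitian M"
  shows "finite (eigenvalues M)"
proof -
  have "\<forall>t\<in>eigenvalues M. \<exists>x. x \<noteq> 0 \<and> M *v x = t *\<^sub>R x"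
    by (simp add: eigenvalues_def)
  then obtain v where v: "\<And>t. t \<in> eigenvalues M \<Longrightarrow> v t \<noteq> 0 \<and> M *v v t = t *\<^sub>R v t"
    by metis
  have inj: "inj_on v (eigenvalues M)"
  proof
    fix s t assume st: "s \<in> eigenvalues M" "t \<in> eigenvalues M" "v s = v t"
    then have "s *\<^sub>R v s = t *\<^sub>R v s" using v by metis
    then show "s = t" using v st by simp
  qed
  have "pairwise orthogonal (v ` eigenvalues M)"
    using v eigenvectors_orthogonal[OF herm] unfolding pairwise_def orthogonal_def by (metis imageE)
  moreover have "0 \<notin> v ` eigenvalues M" using v by auto
  ultimately have "independent (v ` eigenvalues M)" by (rule pairwise_orthogonal_independent)
  then show ?thesis using independent_imp_finite finite_imageD[OF _ inj] by blast
qed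

lemma eigenprojection:
  shows orth_projection_eigenprojection: "orth_projection (proj_onto (eigenspace M t))"
    and eigenprojection_fix_iff: "proj_onto (eigenspace M t) *v x = x \<longleftrightarrow> M *v x = t *\<^sub>R x"
proof -
  show "orth_projection (proj_onto (eigenspace M t))"
    by (rule orth_projection_proj_onto[OF complex_subspace_eigenspace])
  from orth_projection_mem_ran[OF this, of x] mat_ran_proj_onto[OF complex_subspace_eigenspace, of M t]
  show "proj_onto (eigenspace M t) *v x = x \<longleftrightarrow> M *v x = t *\<^sub>R x"
    by (simp add: eigenspace_def)
qed

lemma eigenprojection_eigenvector:
  "M *v (proj_onto (eigenspace M t) *v x) = t *\<^sub>R (proj_onto (eigenspace M t) *v x)"
  using eigenprojection_fix_iff orth_projection_idem[OF orth_projection_eigenprojection] by blast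

lemma eigenprojection_other:
  assumes "hermitian M" "M *v x = s *\<^sub>R x" "s \<noteq> t"
  shows "proj_onto (eigenspace M t) *v x = 0"
proof -
  let ?P = "proj_onto (eigenspace M t)"
  have "x \<bullet> (?P *v x) = 0"
    by (rule eigenvectors_orthogonal[OF assms(1,2) eigenprojection_eigenvector assms(3)])
  then show ?thesis
    using orth_projection_form[OF orth_projection_eigenprojection, of x M t] by simp
qed

lemma fun_calc_eigenvector:
  fixes M :: "complex^'n^'n"
  assumes herm: "hermitian M" and x: "M *v x = t *\<^sub>R x"
  shows "fun_calc f M *v x = f t *\<^sub>R x"
proof (cases "x = 0")
  case False
  then have t: "t \<in> eigenvalues M" using x by (auto simp: eigenvalues_def)
  have "fun_calc f M *v x = (\<Sum>s\<in>eigenvalues M. f s *\<^sub>R (proj_onto (eigenspace M s) *v x))"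
    by (simp add: fun_calc_def matrix_vector_linear_simps)
  also have "\<dots> = (\<Sum>s\<in>eigenvalues M. if s = t then f t *\<^sub>R x else 0)"
    by (intro sum.cong refl) (use eigenprojection_other[OF herm x] eigenprojection_fix_iff x in auto)
  also have "\<dots> = f t *\<^sub>R x" using t finite_eigenvalues[OF herm] by simp
  finally show ?thesis .
qed simp

lemma hermitian_fun_calc: "hermitian (fun_calc f M)"
  unfolding fun_calc_def
  by (intro hermitian_sum hermitian_scaleR)
    (use orth_projection_eigenprojection in \<open>auto simp: orth_projection_def\<close>)

text \<open>Uniqueness of the functional calculus: it is characterised by its action on eigenvectors, so the
  laws below reduce to scalar identities.\<close>

lemma fun_calc_eqI:
  fixes M K :: "complex^'n^'n"
  assumes herm: "hermitian M" and K: "\<And>t x. M *v x = t *\<^sub>R x \<Longrightarrow> K *v x = f t *\<^sub>R x"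
  shows "fun_calc f M = K"
proof (rule matrix_eq_on_eigenvectors[OF herm])
  fix t x assume "M *v x = t *\<^sub>R x"
  then show "fun_calc f M *v x = K *v x"
    using fun_calc_eigenvector[OF herm, of x t f] K[of x t] by simp
qed

lemma fun_calc_id: "hermitian M \<Longrightarrow> fun_calc (\<lambda>t. t) M = M"
  by (rule fun_calc_eqI)

lemma fun_calc_const: "hermitian M \<Longrightarrow> fun_calc (\<lambda>_. c) M = c *\<^sub>R mat 1"
  by (rule fun_calc_eqI) (simp_all add: matrix_vector_linear_simps)

lemma fun_calc_add:
  assumes "hermitian M"
  shows "fun_calc (\<lambda>t. f t + g t) M = fun_calc f M + fun_calc g M"
proof (rule fun_calc_eqI[OF assms])
  fix t x assume x: "M *v x = t *\<^sub>R x"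
  show "(fun_calc f M + fun_calc g M) *v x = (f t + g t) *\<^sub>R x"
    using fun_calc_eigenvector[OF assms x, of f] fun_calc_eigenvector[OF assms x, of g]
    by (simp add: matrix_vector_linear_simps scaleR_add_left)
qed

lemma fun_calc_scaleR:
  assumes "hermitian M"
  shows "fun_calc (\<lambda>t. c * f t) M = c *\<^sub>R fun_calc f M"
proof (rule fun_calc_eqI[OF assms])
  fix t x assume x: "M *v x = t *\<^sub>R x"
  show "(c *\<^sub>R fun_calc f M) *v x = (c * f t) *\<^sub>R x"
    using fun_calc_eigenvector[OF assms x, of f] by (simp add: matrix_vector_linear_simps)
qed

lemma fun_calc_mult:
  assumes "hermitian M"
  shows "fun_calc (\<lambda>t. f t * g t) M = fun_calc f M ** fun_calc g M"
proof (rule fun_calc_eqI[OF assms])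
  fix t x assume x: "M *v x = t *\<^sub>R x"
  show "(fun_calc f M ** fun_calc g M) *v x = (f t * g t) *\<^sub>R x"
    using fun_calc_eigenvector[OF assms x, of f] fun_calc_eigenvector[OF assms x, of g]
    by (simp add: matrix_vector_linear_simps mult.commute flip: matrix_vector_mul_assoc)
qed

lemma fun_calc_compose:
  assumes "hermitian M"
  shows "fun_calc g (fun_calc f M) = fun_calc (\<lambda>t. g (f t)) M"
  by (rule fun_calc_eqI[OF assms, symmetric])
    (intro fun_calc_eigenvector hermitian_fun_calc assms)

lemma fun_calc_cong: "(\<And>t. t \<in> eigenvalues M \<Longrightarrow> f t = g t) \<Longrightarrow> fun_calc f M = fun_calc g M"
  by (simp add: fun_calc_def)

lemma fun_calc_form:
  "x \<bullet> (fun_calc f M *v x) = (\<Sum>t\<in>eigenvalues M. f t * (norm (proj_onto (eigenspace M t) *v x))\<^sup>2)"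
  by (simp add: fun_calc_def matrix_vector_linear_simps inner_sum_right
      orth_projection_form[OF orth_projection_eigenprojection])

section \<open>The Loewner order and the Loewner-Heinz inequality\<close>

definition loewner_le :: "complex^'n^'n \<Rightarrow> complex^'n^'n \<Rightarrow> bool" (infix "\<preceq>" 50) where
  "M \<preceq> N \<longleftrightarrow> (\<forall>x. x \<bullet> (M *v x) \<le> x \<bullet> (N *v x))"

lemma loewner_le_trans: "K \<preceq> M \<Longrightarrow> M \<preceq> N \<Longrightarrow> K \<preceq> N"
  unfolding loewner_le_def by (meson order_trans)

lemma loewner_leD: "M \<preceq> N \<Longrightarrow> x \<bullet> (M *v x) \<le> x \<bullet> (N *v x)"
  by (simp add: loewner_le_def)

lemma loewner_le_congruence:
  assumes "M \<preceq> N" and S: "hermitian S"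
  shows "S ** M ** S \<preceq> S ** N ** S"
  using assms(1) by (simp add: loewner_le_def hermitian_inner[OF S, symmetric] flip: matrix_vector_mul_assoc)

lemma pos_semidef_hermitian: "pos_semidef M \<Longrightarrow> hermitian M"
  by (simp add: pos_semidef_def)

lemma pos_def_hermitian: "pos_def M \<Longrightarrow> hermitian M"
  by (simp add: pos_def_def)

lemma pos_def_imp_pos_semidef: "pos_def M \<Longrightarrow> pos_semidef M"
  unfolding pos_def_def pos_semidef_def by (metis inner_zero_left order.refl order.strict_implies_order)

lemma pos_semidef_eigenvalue_nonneg:
  assumes "pos_semidef M" "t \<in> eigenvalues M"
  shows "0 \<le> t"
proof -
  obtain x where x: "x \<noteq> 0" "M *v x = t *\<^sub>R x" using assms(2) by (auto simp: eigenvalues_def)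
  have "0 \<le> x \<bullet> (M *v x)" using assms(1) by (simp add: pos_semidef_def)
  then have "0 \<le> t * (x \<bullet> x)" by (simp add: x)
  moreover have "0 < x \<bullet> x" using x by simp
  ultimately show ?thesis by (simp add: zero_le_mult_iff)
qed

lemma pos_def_eigenvalue_pos:
  assumes "pos_def M" "t \<in> eigenvalues M"
  shows "0 < t"
proof -
  obtain x where x: "x \<noteq> 0" "M *v x = t *\<^sub>R x" using assms(2) by (auto simp: eigenvalues_def)
  have "0 < x \<bullet> (M *v x)" using assms(1) x(1) by (simp add: pos_def_def)
  then have "0 < t * (x \<bullet> x)" by (simp add: x)
  moreover have "0 < x \<bullet> x" using x by simp
  ultimately show ?thesis by (simp add: zero_less_mult_iff)
qed

lemma pos_def_add_scaleR_mat_1: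
  assumes "pos_semidef M" "0 < \<delta>"
  shows "pos_def (M + \<delta> *\<^sub>R mat 1)"
  using assms unfolding pos_def_def pos_semidef_def
  by (simp add: hermitian_add hermitian_scaleR hermitian_mat_1 matrix_vector_linear_simps inner_add
      add_nonneg_pos)

lemma fun_calc_mono:
  assumes "\<And>t. t \<in> eigenvalues M \<Longrightarrow> f t \<le> g t"
  shows "fun_calc f M \<preceq> fun_calc g M"
  unfolding loewner_le_def fun_calc_form by (intro allI sum_mono mult_right_mono assms) auto

lemma loewner_le_scaleR_mat_1:
  assumes "hermitian M" "\<And>t. t \<in> eigenvalues M \<Longrightarrow> t \<le> c"
  shows "M \<preceq> c *\<^sub>R mat 1"
  using fun_calc_mono[of M "\<lambda>t. t" "\<lambda>_. c"] assms by (simp add: fun_calc_id fun_calc_const)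

subsection \<open>Powers\<close>

lemma hermitian_mat_powr: "hermitian (mat_powr M r)"
  by (simp add: mat_powr_def hermitian_fun_calc)

lemma pos_semidef_mat_powr: "pos_semidef (mat_powr M r)"
  unfolding pos_semidef_def mat_powr_def fun_calc_form
  by (auto intro!: hermitian_fun_calc sum_nonneg)

lemma mat_powr_add_exponents:
  "hermitian M \<Longrightarrow> mat_powr M r *v (mat_powr M s *v x) = mat_powr M (r + s) *v x"
  unfolding mat_powr_def powr_add by (simp add: fun_calc_mult matrix_vector_mul_assoc)

lemma mat_powr_one: "pos_semidef M \<Longrightarrow> mat_powr M 1 = M"
  unfolding mat_powr_def
  using fun_calc_cong[of M "\<lambda>t. t powr 1" "\<lambda>t. t"]
  by (simp add: pos_semidef_eigenvalue_nonneg fun_calc_id pos_semidef_hermitian)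

lemma mat_powr_zero: "pos_def M \<Longrightarrow> mat_powr M 0 = mat 1"
  unfolding mat_powr_def
  using fun_calc_cong[of M "\<lambda>t. t powr 0" "\<lambda>t. 1"]
  by (force simp: fun_calc_const pos_def_hermitian dest: pos_def_eigenvalue_pos)

lemma mat_powr_cancel:
  assumes "pos_def M"
  shows "mat_powr M r *v (mat_powr M (- r) *v x) = x" "mat_powr M (- r) *v (mat_powr M r *v x) = x"
  by (simp_all add: mat_powr_add_exponents pos_def_hermitian assms mat_powr_zero)

lemma norm_mat_powr_half:
  assumes "hermitian M"
  shows "(norm (mat_powr M (r/2) *v x))\<^sup>2 = x \<bullet> (mat_powr M r *v x)"
  by (simp add: hermitian_inner[OF hermitian_mat_powr] mat_powr_add_exponents assms flip: dot_square_norm)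

lemma mat_powr_shift:
  assumes "hermitian M"
  shows "mat_powr (M + \<delta> *\<^sub>R mat 1) r = fun_calc (\<lambda>t. (t + \<delta>) powr r) M"
proof -
  have "M + \<delta> *\<^sub>R mat 1 = fun_calc (\<lambda>t. t + \<delta>) M"
    by (simp add: fun_calc_add fun_calc_const fun_calc_id assms)
  then show ?thesis by (simp add: mat_powr_def fun_calc_compose assms)
qed

subsection \<open>Loewner-Heinz\<close>

text \<open>The set of exponents for which the power is monotone is closed under midpoints. With \<open>u =
  (r + s)/2\<close> the claim is that the eigenvalues of \<open>Z =
  Y\<^sup>-\<^sup>u\<^sup>/\<^sup>2 X\<^sup>u Y\<^sup>-\<^sup>u\<^sup>/\<^sup>2\<close> are at
  most 1. Such an eigenvalue is also an eigenvalue of the similar product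
  \<open>(Y\<^sup>-\<^sup>s\<^sup>/\<^sup>2 X\<^sup>s\<^sup>/\<^sup>2)(X\<^sup>r\<^sup>/\<^sup>2
  Y\<^sup>-\<^sup>r\<^sup>/\<^sup>2)\<close>, and both factors are contractions by hypothesis.\<close>

lemma loewner_heinz_midpoint:
  assumes X: "pos_def X" and Y: "pos_def Y"
    and r: "mat_powr X r \<preceq> mat_powr Y r" and s: "mat_powr X s \<preceq> mat_powr Y s"
  shows "mat_powr X ((r + s) / 2) \<preceq> mat_powr Y ((r + s) / 2)"
proof -
  note herm = pos_def_hermitian[OF X] pos_def_hermitian[OF Y]
  have norm_le: "norm (mat_powr X (q/2) *v x) \<le> norm (mat_powr Y (q/2) *v x)"
    if "mat_powr X q \<preceq> mat_powr Y q" for q x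
    using loewner_leD[OF that, of x] norm_mat_powr_half[OF herm(1), of q x]
      norm_mat_powr_half[OF herm(2), of q x]
    by (intro power2_le_imp_le[OF _ norm_ge_zero]) linarith
  define u where "u = (r + s) / 2"
  define Z where "Z = mat_powr Y (-(u/2)) ** mat_powr X u ** mat_powr Y (-(u/2))"
  have hZ: "hermitian Z"
    unfolding Z_def by (intro hermitian_congruence hermitian_mat_powr)
  have "Z \<preceq> 1 *\<^sub>R mat 1"
  proof (rule loewner_le_scaleR_mat_1[OF hZ])
    fix l assume "l \<in> eigenvalues Z"
    then obtain v where v: "v \<noteq> 0" "Z *v v = l *\<^sub>R v" by (auto simp: eigenvalues_def)
    define w where "w = mat_powr Y (-(u/2)) *v v"
    \<comment> \<open>\<open>z\<close> is the eigenvector of \<open>(Y\<^sup>-\<^sup>s\<^sup>/\<^sup>2 X\<^sup>s\<^sup>/\<^sup>2)(X\<^sup>r\<^sup>/\<^sup>2 Y\<^sup>-\<^sup>r\<^sup>/\<^sup>2)\<close> that corresponds to \<open>v\<close>.\<close>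
    define z where "z = mat_powr Y (r/2) *v w"
    have Yw: "mat_powr Y q *v w = mat_powr Y (q - u/2) *v v" for q
      unfolding w_def by (simp add: mat_powr_add_exponents herm)
    have "mat_powr X u *v w = mat_powr Y (u/2) *v (Z *v v)"
      unfolding Z_def w_def by (simp add: mat_powr_cancel[OF Y] flip: matrix_vector_mul_assoc)
    also have "\<dots> = l *\<^sub>R (mat_powr Y (u/2) *v v)"
      unfolding v by (simp add: matrix_vector_linear_simps)
    finally have Xw: "mat_powr X u *v w = l *\<^sub>R (mat_powr Y (u/2) *v v)" .
    have "mat_powr Y (-(s/2)) *v (mat_powr X u *v w) = l *\<^sub>R (mat_powr Y (-(s/2) + u/2) *v v)"
      unfolding Xw by (simp only: matrix_vector_linear_simps mat_powr_add_exponents herm)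
    also have "-(s/2) + u/2 = r/2 - u/2" by (simp add: u_def field_simps)
    finally have "mat_powr Y (-(s/2)) *v (mat_powr X u *v w) = l *\<^sub>R z"
      by (simp only: z_def Yw)
    moreover have "s/2 + r/2 = u" by (simp add: u_def)
    then have "mat_powr X u *v w = mat_powr X (s/2) *v (mat_powr X (r/2) *v w)"
      by (simp add: mat_powr_add_exponents herm)
    ultimately have "l * (norm z)\<^sup>2
        = z \<bullet> (mat_powr Y (-(s/2)) *v (mat_powr X (s/2) *v (mat_powr X (r/2) *v w)))"
      by (simp add: dot_square_norm)
    also have "\<dots> = (mat_powr X (s/2) *v (mat_powr Y (-(s/2)) *v z)) \<bullet> (mat_powr X (r/2) *v w)"
      by (simp add: hermitian_inner[OF hermitian_mat_powr])
    also have "\<dots> \<le> norm (mat_powr X (s/2) *v (mat_powr Y (-(s/2)) *v z)) * norm (mat_powr X (r/2) *v w)"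
      by (rule norm_cauchy_schwarz)
    also have "\<dots> \<le> norm (mat_powr Y (s/2) *v (mat_powr Y (-(s/2)) *v z)) * norm (mat_powr Y (r/2) *v w)"
      by (intro mult_mono norm_le r s) auto
    also have "\<dots> = (norm z)\<^sup>2"
      by (simp add: mat_powr_cancel[OF Y] power2_eq_square flip: z_def)
    finally have "l * (norm z)\<^sup>2 \<le> 1 * (norm z)\<^sup>2" by simp
    moreover have "z \<noteq> 0"
    proof
      assume "z = 0"
      then have "mat_powr Y (-(r/2-u/2)) *v (mat_powr Y (r/2-u/2) *v v) = 0" by (simp add: z_def Yw)
      with v(1) show False by (simp only: mat_powr_cancel[OF Y])
    qed
    ultimately show "l \<le> 1" by (simp only: mult_le_cancel_right) auto
  qed
  then have "mat_powr Y (u/2) ** Z ** mat_powr Y (u/2) \<preceq> mat_powr Y (u/2) ** (1 *\<^sub>R mat 1) ** mat_powr Y (u/2)"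
    by (rule loewner_le_congruence[OF _ hermitian_mat_powr])
  moreover have "mat_powr Y (u/2) ** Z ** mat_powr Y (u/2) = mat_powr X u"
    unfolding Z_def by (simp add: matrix_eq mat_powr_cancel[OF Y] flip: matrix_vector_mul_assoc)
  moreover have "mat_powr Y (u/2) ** (1 *\<^sub>R mat 1) ** mat_powr Y (u/2) = mat_powr Y u"
    by (simp add: matrix_eq mat_powr_add_exponents herm flip: matrix_vector_mul_assoc)
  ultimately show ?thesis by (simp add: u_def)
qed

text \<open>A gap in \<open>S\<close> around a missing point has endpoints in \<open>S\<close>, and its
  midpoint would lie in \<open>S\<close>.\<close>

lemma closed_midpoint_convex_contains_unit_interval:
  fixes S :: "real set"
  assumes "closed S" "0 \<in> S" "1 \<in> S"
    and mid: "\<And>r s. r \<in> S \<Longrightarrow> s \<in> S \<Longrightarrow> (r + s) / 2 \<in> S"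
  shows "{0..1} \<subseteq> S"
proof (rule ccontr)
  assume "\<not> {0..1} \<subseteq> S"
  then obtain r where r: "0 \<le> r" "r \<le> 1" "r \<notin> S" by (meson atLeastAtMost_iff subsetI)
  have "compact (S \<inter> {0..r})" "compact (S \<inter> {r..1})"
    using assms(1) by (auto intro: closed_Int_compact)
  moreover have "0 \<in> S \<inter> {0..r}" "1 \<in> S \<inter> {r..1}" using assms r by auto
  ultimately obtain s u where s: "s \<in> S \<inter> {0..r}" "\<And>t. t \<in> S \<inter> {0..r} \<Longrightarrow> t \<le> s"
    and u: "u \<in> S \<inter> {r..1}" "\<And>t. t \<in> S \<inter> {r..1} \<Longrightarrow> u \<le> t"
    using compact_attains_sup[of "S \<inter> {0..r}"] compact_attains_inf[of "S \<inter> {r..1}"] by blast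
  have "s \<noteq> r" "u \<noteq> r" using s u r by auto
  then have su: "s < r" "r < u" using s u by auto
  have m: "(s + u) / 2 \<in> S" using mid s u by auto
  show False
  proof (cases "(s + u) / 2 \<le> r")
    case True
    then have "(s + u) / 2 \<le> s" using s u m su by (intro s) auto
    then show False using su by simp
  next
    case False
    then have "u \<le> (s + u) / 2" using s u m su by (intro u) auto
    then show False using su by simp
  qed
qed

text \<open>The admissible exponents form a closed midpoint-convex set containing 0 and 1.\<close>

lemma loewner_heinz_pos_def:
  assumes X: "pos_def X" and Y: "pos_def Y" and le: "X \<preceq> Y" and r: "0 \<le> r" "r \<le> 1"
  shows "mat_powr X r \<preceq> mat_powr Y r"
proof -
  have cont: "continuous_on UNIV (\<lambda>r. x \<bullet> (mat_powr M r *v x))" if M: "pos_def M" for M and x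
    unfolding mat_powr_def fun_calc_form
    by (intro continuous_intros) (use pos_def_eigenvalue_pos[OF M] in auto)
  have "closed {r. mat_powr X r \<preceq> mat_powr Y r}"
    unfolding loewner_le_def by (intro closed_Collect_all closed_Collect_le cont X Y)
  moreover have "mat_powr X 0 \<preceq> mat_powr Y 0" by (simp add: mat_powr_zero X Y loewner_le_def)
  moreover have "mat_powr X 1 \<preceq> mat_powr Y 1"
    by (simp add: mat_powr_one pos_def_imp_pos_semidef X Y le)
  ultimately have "{0..1} \<subseteq> {r. mat_powr X r \<preceq> mat_powr Y r}"
    using loewner_heinz_midpoint[OF X Y]
    by (intro closed_midpoint_convex_contains_unit_interval) auto
  with r show ?thesis by auto
qed

text \<open>The semidefinite case follows from the definite one by adding \<open>\<delta>\<close> to both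
  matrices; \<open>r > 0\<close> makes \<open>t powr r\<close> continuous at \<open>t =
  0\<close>.\<close>

theorem loewner_heinz:
  fixes X Y :: "complex^'n^'n"
  assumes X: "pos_semidef X" and Y: "pos_semidef Y" and le: "X \<preceq> Y" and r: "0 < r" "r \<le> 1"
  shows "mat_powr X r \<preceq> mat_powr Y r"
  unfolding loewner_le_def
proof
  fix x :: "complex^'n"
  have lim: "((\<lambda>\<delta>. x \<bullet> (mat_powr (M + \<delta> *\<^sub>R mat 1) r *v x)) \<longlongrightarrow> x \<bullet> (mat_powr M r *v x)) (at_right 0)"
    if M: "pos_semidef M" for M :: "complex^'n^'n"
  proof -
    have *: "((\<lambda>\<delta>. (t + \<delta>) powr r) \<longlongrightarrow> (t + 0) powr r) (at_right 0)" if "t \<in> eigenvalues M" for t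
    proof (rule tendsto_powr')
      show "((+) t \<longlongrightarrow> t + 0) (at_right 0)" by (intro tendsto_intros)
      have "\<forall>\<^sub>F \<delta> in at_right 0. 0 \<le> t + \<delta>"
        using eventually_at_right_less[of 0] pos_semidef_eigenvalue_nonneg[OF M that]
        by (auto elim!: eventually_mono)
      then show "t + 0 \<noteq> 0 \<or> 0 < r \<and> (\<forall>\<^sub>F \<delta> in at_right 0. 0 \<le> t + \<delta>)" using r by simp
    qed auto
    have "((\<lambda>\<delta>. x \<bullet> (fun_calc (\<lambda>t. (t + \<delta>) powr r) M *v x))
        \<longlongrightarrow> x \<bullet> (fun_calc (\<lambda>t. t powr r) M *v x)) (at_right 0)"
      unfolding fun_calc_form using * by (intro tendsto_sum tendsto_mult tendsto_const) simp_all
    then show ?thesis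
      unfolding mat_powr_shift[OF pos_semidef_hermitian[OF M]] by (simp only: mat_powr_def)
  qed
  show "x \<bullet> (mat_powr X r *v x) \<le> x \<bullet> (mat_powr Y r *v x)"
  proof (rule tendsto_le[OF _ lim[OF Y] lim[OF X]])
    have "x \<bullet> (mat_powr (X + \<delta> *\<^sub>R mat 1) r *v x) \<le> x \<bullet> (mat_powr (Y + \<delta> *\<^sub>R mat 1) r *v x)"
      if "0 < \<delta>" for \<delta>
    proof (intro loewner_leD loewner_heinz_pos_def pos_def_add_scaleR_mat_1 X Y that)
      show "X + \<delta> *\<^sub>R mat 1 \<preceq> Y + \<delta> *\<^sub>R mat 1"
        using le by (simp add: loewner_le_def matrix_vector_linear_simps inner_add)
    qed (use r in auto)
    then show "\<forall>\<^sub>F \<delta> in at_right 0. x \<bullet> (mat_powr (X + \<delta> *\<^sub>R mat 1) r *v x)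
        \<le> x \<bullet> (mat_powr (Y + \<delta> *\<^sub>R mat 1) r *v x)"
      using eventually_at_right_less[of 0] by (auto elim!: eventually_mono)
  qed simp
qed

section \<open>Convergence of Hermitian matrices through their quadratic forms\<close>

lemma matrix_entry_eq_inner:
  fixes M :: "complex^'n^'n"
  shows "M $ i $ j = Complex (axis i 1 \<bullet> (M *v axis j 1)) (axis i \<i> \<bullet> (M *v axis j 1))"
proof -
  have "(M *v axis j 1) $ i = M $ i $ j"
    by (simp add: matrix_vector_mult_def axis_def if_distrib cong: if_cong)
  then show ?thesis by (simp add: inner_axis' inner_complex_def complex_eq_iff)
qed

lemma hermitian_polarization:
  assumes "hermitian M"
  shows "x \<bullet> (M *v y) = ((x + y) \<bullet> (M *v (x + y)) - (x - y) \<bullet> (M *v (x - y))) / 4"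
proof -
  have "y \<bullet> (M *v x) = x \<bullet> (M *v y)"
    using hermitian_inner[OF assms, of x y] by (simp add: inner_commute)
  then show ?thesis by (simp add: matrix_vector_linear_simps inner_add inner_diff)
qed

lemma hermitian_eqI_form:
  assumes "hermitian M" "hermitian N" "\<And>x. x \<bullet> (M *v x) = x \<bullet> (N *v x)"
  shows "M = N"
proof -
  have "M *v y = N *v y" for y
  proof -
    have "\<forall>x. x \<bullet> (M *v y) = x \<bullet> (N *v y)"
      by (simp only: hermitian_polarization[OF assms(1), of _ y] hermitian_polarization[OF assms(2), of _ y]
          assms(3) simp_thms)
    then show ?thesis by (simp only: vector_eq_ldot)
  qed
  then show ?thesis by (simp add: matrix_eq)
qed

lemma tendsto_inner_matrix_vector:
  fixes M :: "'a \<Rightarrow> complex^'n^'n"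
  assumes "(M \<longlongrightarrow> L) F"
  shows "((\<lambda>p. x \<bullet> (M p *v y)) \<longlongrightarrow> x \<bullet> (L *v y)) F"
proof (intro tendsto_inner tendsto_const vec_tendstoI)
  show "((\<lambda>p. (M p *v y) $ i) \<longlongrightarrow> (L *v y) $ i) F" for i
    unfolding matrix_vector_mult_def vec_lambda_beta
    by (rule tendsto_sum, rule tendsto_mult[OF _ tendsto_const], rule tendsto_vec_nth,
        rule tendsto_vec_nth, rule assms)
qed

lemma hermitian_limit:
  fixes M :: "'a \<Rightarrow> complex^'n^'n"
  assumes "F \<noteq> bot" "\<forall>\<^sub>F p in F. hermitian (M p)" and lim: "(M \<longlongrightarrow> L) F"
  shows "hermitian L"
  unfolding hermitian_iff_selfadjoint
proof (intro allI)
  fix x y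
  have "\<forall>\<^sub>F p in F. y \<bullet> (M p *v x) = x \<bullet> (M p *v y)"
    using assms(2) by eventually_elim (simp only: inner_commute[of y] hermitian_inner)
  then have "((\<lambda>p. x \<bullet> (M p *v y)) \<longlongrightarrow> y \<bullet> (L *v x)) F"
    using tendsto_inner_matrix_vector[OF lim, of y x] by (simp add: tendsto_cong)
  from tendsto_unique[OF assms(1) this tendsto_inner_matrix_vector[OF lim]]
  show "(L *v x) \<bullet> y = x \<bullet> (L *v y)" by (simp add: inner_commute)
qed

text \<open>Polarisation turns convergence of all quadratic forms into convergence of the matrix entries; no
  candidate for the limit has to be known.\<close>

lemma convergent_of_forms:
  fixes M :: "'a \<Rightarrow> complex^'n^'n"
  assumes herm: "\<forall>\<^sub>F p in F. hermitian (M p)"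
    and forms: "\<And>x. \<exists>l. ((\<lambda>p. x \<bullet> (M p *v x)) \<longlongrightarrow> l) F"
  shows "\<exists>L. (M \<longlongrightarrow> L) F"
proof -
  obtain q where q: "\<And>x. ((\<lambda>p. x \<bullet> (M p *v x)) \<longlongrightarrow> q x) F" using forms by metis
  define b where "b x y = (q (x + y) - q (x - y)) / 4" for x y
  have b: "((\<lambda>p. x \<bullet> (M p *v y)) \<longlongrightarrow> b x y) F" for x y
  proof -
    have "((\<lambda>p. ((x + y) \<bullet> (M p *v (x + y)) - (x - y) \<bullet> (M p *v (x - y))) / 4) \<longlongrightarrow> b x y) F"
      unfolding b_def by (intro tendsto_intros q) simp
    moreover have "\<forall>\<^sub>F p in F. x \<bullet> (M p *v y)
        = ((x + y) \<bullet> (M p *v (x + y)) - (x - y) \<bullet> (M p *v (x - y))) / 4"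
      using herm by eventually_elim (rule hermitian_polarization)
    ultimately show ?thesis by (simp only: tendsto_cong)
  qed
  define L :: "complex^'n^'n" where
    "L = (\<chi> i j. Complex (b (axis i 1) (axis j 1)) (b (axis i \<i>) (axis j 1)))"
  have "((\<lambda>p. M p $ i $ j) \<longlongrightarrow> L $ i $ j) F" for i j
  proof -
    have "(\<lambda>p. M p $ i $ j)
        = (\<lambda>p. Complex (axis i 1 \<bullet> (M p *v axis j 1)) (axis i \<i> \<bullet> (M p *v axis j 1)))"
      by (rule ext) (rule matrix_entry_eq_inner)
    then show ?thesis unfolding L_def by (simp only: vec_lambda_beta tendsto_Complex b)
  qed
  then have "(M \<longlongrightarrow> L) F" by (intro vec_tendstoI)
  then show ?thesis by blast
qed

lemma tendsto_hermitianI: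
  fixes M :: "'a \<Rightarrow> complex^'n^'n"
  assumes "F \<noteq> bot" and herm: "\<forall>\<^sub>F p in F. hermitian (M p)" "hermitian L"
    and forms: "\<And>x. ((\<lambda>p. x \<bullet> (M p *v x)) \<longlongrightarrow> x \<bullet> (L *v x)) F"
  shows "(M \<longlongrightarrow> L) F"
proof -
  obtain L' where L': "(M \<longlongrightarrow> L') F" using convergent_of_forms[OF herm(1)] forms by blast
  have "L' = L"
  proof (rule hermitian_eqI_form[OF hermitian_limit[OF assms(1) herm(1) L'] herm(2)])
    fix x show "x \<bullet> (L' *v x) = x \<bullet> (L *v x)"
      by (rule tendsto_unique[OF assms(1) tendsto_inner_matrix_vector[OF L'] forms])
  qed
  with L' show ?thesis by simp
qed

section \<open>The weighted geometric mean\<close>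

subsection \<open>Positive definite first argument\<close>

lemma pos_semidef_congruence:
  assumes "hermitian S" "pos_semidef M"
  shows "pos_semidef (S ** M ** S)"
  unfolding pos_semidef_def
proof (intro conjI allI)
  show "hermitian (S ** M ** S)"
    using assms by (simp add: hermitian_congruence pos_semidef_def)
  fix x
  have "x \<bullet> ((S ** M ** S) *v x) = (S *v x) \<bullet> (M *v (S *v x))"
    by (simp only: hermitian_inner[OF assms(1)] matrix_vector_mul_assoc matrix_mul_assoc)
  then show "0 \<le> x \<bullet> ((S ** M ** S) *v x)"
    using assms(2) by (simp add: pos_semidef_def)
qed

lemma mat_powr_half_cancel:
  assumes "pos_def A"
  shows "mat_powr A (1/2) *v (mat_powr A (-(1/2)) *v x) = x"
    and "mat_powr A (-(1/2)) *v (mat_powr A (1/2) *v x) = x"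
  using mat_powr_cancel[OF assms, of "1/2" x] by simp_all

lemma mat_powr_half_square:
  assumes "pos_semidef A"
  shows "mat_powr A (1/2) *v (mat_powr A (1/2) *v x) = A *v x"
  using mat_powr_add_exponents[OF pos_semidef_hermitian[OF assms], of "1/2" "1/2" x] mat_powr_one[OF assms] by simp

text \<open>The exponent is written in the form to which the simplifier normalises \<open>-1/2\<close>.\<close>

lemma geo_mean_pd_eq:
  "geo_mean_pd \<alpha> A B = mat_powr A (1/2) **
     mat_powr (mat_powr A (-(1/2)) ** B ** mat_powr A (-(1/2))) \<alpha> ** mat_powr A (1/2)"
  by (simp add: geo_mean_pd_def)

lemma pos_semidef_geo_mean_pd: "pos_semidef (geo_mean_pd \<alpha> A B)"
  unfolding geo_mean_pd_eq
  by (intro pos_semidef_congruence hermitian_mat_powr pos_semidef_mat_powr)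

lemma geo_mean_pd_mono_right:
  assumes "pos_semidef B" "pos_semidef B'" "B \<preceq> B'" "0 < \<alpha>" "\<alpha> \<le> 1"
  shows "geo_mean_pd \<alpha> A B \<preceq> geo_mean_pd \<alpha> A B'"
  unfolding geo_mean_pd_eq
  by (intro loewner_le_congruence loewner_heinz pos_semidef_congruence hermitian_mat_powr assms)

text \<open>With \<open>C = A\<^sup>-\<^sup>1\<^sup>/\<^sup>2 B A\<^sup>-\<^sup>1\<^sup>/\<^sup>2\<close>
  and \<open>C' = B\<^sup>-\<^sup>1\<^sup>/\<^sup>2 A B\<^sup>-\<^sup>1\<^sup>/\<^sup>2\<close>,
  the map \<open>B\<^sup>1\<^sup>/\<^sup>2 A\<^sup>-\<^sup>1\<^sup>/\<^sup>2\<close> takes an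
  eigenvector of \<open>C\<close> with eigenvalue \<open>t\<close> to an eigenvector of
  \<open>C'\<close> with eigenvalue \<open>1/t\<close>. Evaluating both means at
  \<open>A\<^sup>-\<^sup>1\<^sup>/\<^sup>2 v\<close> for such eigenvectors \<open>v\<close>
  gives \<open>t\<^sup>\<alpha> A\<^sup>1\<^sup>/\<^sup>2 v\<close> in either case.\<close>

lemma geo_mean_pd_commute:
  assumes A: "pos_def A" and B: "pos_def B"
  shows "geo_mean_pd \<alpha> A B = geo_mean_pd (1 - \<alpha>) B A"
proof -
  let ?Ai = "mat_powr A (-(1/2))" and ?Bi = "mat_powr B (-(1/2))"
  let ?Ah = "mat_powr A (1/2)" and ?Bh = "mat_powr B (1/2)"
  define C where "C = ?Ai ** B ** ?Ai"
  define C' where "C' = ?Bi ** A ** ?Bi"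
  note cancel = mat_powr_half_cancel[OF A] mat_powr_half_cancel[OF B]
  note square = mat_powr_half_square[OF pos_def_imp_pos_semidef[OF A]]
    mat_powr_half_square[OF pos_def_imp_pos_semidef[OF B]]
  have hC: "hermitian C" and hC': "hermitian C'"
    unfolding C_def C'_def
    by (intro hermitian_congruence hermitian_mat_powr pos_def_hermitian A B)+
  have "geo_mean_pd \<alpha> A B ** ?Ai = geo_mean_pd (1 - \<alpha>) B A ** ?Ai"
  proof (rule matrix_eq_on_eigenvectors[OF hC])
    fix t v assume v: "C *v v = t *\<^sub>R v"
    show "(geo_mean_pd \<alpha> A B ** ?Ai) *v v = (geo_mean_pd (1 - \<alpha>) B A ** ?Ai) *v v"
    proof (cases "v = 0")
      case False
      have "0 < v \<bullet> (C *v v)"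
      proof -
        have "?Ai *v v \<noteq> 0" using False cancel(1)[of v] by auto
        then have "0 < (?Ai *v v) \<bullet> (B *v (?Ai *v v))" using B by (simp add: pos_def_def)
        then show ?thesis by (simp add: C_def hermitian_inner[OF hermitian_mat_powr] flip: matrix_vector_mul_assoc)
      qed
      then have "0 < t * (v \<bullet> v)" by (simp add: v)
      moreover have "0 < v \<bullet> v" using False by simp
      ultimately have t: "0 < t" by (rule zero_less_mult_pos2)
      define u where "u = ?Bh *v (?Ai *v v)"
      have Bv: "?Bh *v u = t *\<^sub>R (?Ah *v v)"
      proof -
        have "?Bh *v u = ?Ah *v (C *v v)"
          unfolding u_def C_def by (simp add: square cancel flip: matrix_vector_mul_assoc)
        then show ?thesis unfolding v by (simp add: matrix_vector_linear_simps)
      qed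
      have Av: "A *v (?Ai *v v) = ?Ah *v v"
        using square(1)[of "?Ai *v v"] by (simp add: cancel)
      have "C' *v u = ?Bi *v (?Ah *v v)"
        unfolding C'_def u_def by (simp add: cancel Av flip: matrix_vector_mul_assoc)
      also have "?Ah *v v = inverse t *\<^sub>R (?Bh *v u)" using t by (simp add: Bv)
      also have "?Bi *v (inverse t *\<^sub>R (?Bh *v u)) = inverse t *\<^sub>R u"
        by (simp add: matrix_vector_linear_simps cancel)
      finally have u: "C' *v u = inverse t *\<^sub>R u" .
      have "(geo_mean_pd (1 - \<alpha>) B A ** ?Ai) *v v = ?Bh *v (mat_powr C' (1 - \<alpha>) *v u)"
        unfolding geo_mean_pd_eq C'_def[symmetric] u_def by (simp flip: matrix_vector_mul_assoc)
      also have "\<dots> = (inverse t powr (1 - \<alpha>) * t) *\<^sub>R (?Ah *v v)"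
        unfolding mat_powr_def fun_calc_eigenvector[OF hC' u] by (simp add: matrix_vector_linear_simps Bv[unfolded mat_powr_def])
      also have "inverse t powr (1 - \<alpha>) * t = t powr \<alpha>"
      proof -
        have "t powr (1 - \<alpha>) * t powr \<alpha> = t" using t by (simp flip: powr_add)
        moreover have "inverse t powr (1 - \<alpha>) = inverse (t powr (1 - \<alpha>))"
          by (rule inverse_powr)
        ultimately show ?thesis using t by (metis (no_types) less_irrefl mult.assoc mult_1 powr_gt_zero
              left_inverse)
      qed
      finally show ?thesis
        unfolding geo_mean_pd_eq C_def[symmetric]
        using fun_calc_eigenvector[OF hC v, of "\<lambda>t. t powr \<alpha>"]
        by (simp add: cancel matrix_vector_linear_simps mat_powr_def[of C] flip: matrix_vector_mul_assoc)
    qed simp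
  qed
  then have "geo_mean_pd \<alpha> A B ** ?Ai ** ?Ah = geo_mean_pd (1 - \<alpha>) B A ** ?Ai ** ?Ah" by simp
  then show ?thesis by (simp add: matrix_eq cancel flip: matrix_vector_mul_assoc)
qed

text \<open>Monotonicity in the right argument is Loewner-Heinz; symmetry transfers it to the left one.\<close>

lemma geo_mean_pd_mono:
  assumes "pos_def A" "pos_def A'" "pos_def B" "pos_def B'" "A \<preceq> A'" "B \<preceq> B'" "0 < \<alpha>" "\<alpha> < 1"
  shows "geo_mean_pd \<alpha> A B \<preceq> geo_mean_pd \<alpha> A' B'"
proof (rule loewner_le_trans)
  show "geo_mean_pd \<alpha> A B \<preceq> geo_mean_pd \<alpha> A B'"
    using assms by (intro geo_mean_pd_mono_right pos_def_imp_pos_semidef) auto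
  show "geo_mean_pd \<alpha> A B' \<preceq> geo_mean_pd \<alpha> A' B'"
    unfolding geo_mean_pd_commute[OF assms(1,4)] geo_mean_pd_commute[OF assms(2,4)]
    using assms by (intro geo_mean_pd_mono_right pos_def_imp_pos_semidef) auto
qed

text \<open>The graph of the concave function \<open>t \<mapsto> t powr \<alpha>\<close> lies below its
  tangent at \<open>s\<close>.\<close>

lemma powr_le_tangent:
  fixes s t \<alpha> :: real
  assumes "0 < s" "0 \<le> t" "0 < \<alpha>" "\<alpha> < 1"
  shows "t powr \<alpha> \<le> (\<alpha> * s powr (\<alpha> - 1)) * t + (1 - \<alpha>) * s powr \<alpha>"
proof (cases "t = 0")
  case False
  have "t powr \<alpha> = (t powr \<alpha> * s powr (1 - \<alpha>)) * s powr (\<alpha> - 1)"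
    using assms by (simp add: mult.assoc flip: powr_add)
  also have "\<dots> \<le> (\<alpha> * t + (1 - \<alpha>) * s) * s powr (\<alpha> - 1)"
    using assms False by (intro mult_right_mono Youngs_inequality_0) auto
  also have "\<dots> = (\<alpha> * s powr (\<alpha> - 1)) * t + (1 - \<alpha>) * (s powr 1 * s powr (\<alpha> - 1))"
    using assms by (simp add: algebra_simps)
  also have "s powr 1 * s powr (\<alpha> - 1) = s powr \<alpha>" by (subst powr_add[symmetric]) simp
  finally show ?thesis .
qed (use assms in simp)

text \<open>The tangent inequality, applied by functional calculus to
  \<open>A\<^sup>-\<^sup>1\<^sup>/\<^sup>2 B A\<^sup>-\<^sup>1\<^sup>/\<^sup>2\<close> and
  conjugated by \<open>A\<^sup>1\<^sup>/\<^sup>2\<close>. Keeping the parameter \<open>s\<close>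
  free recovers, on optimising, the bound \<open>(x \<bullet> A
  x)\<^sup>1\<^sup>-\<^sup>\<alpha> (x \<bullet> B x)\<^sup>\<alpha>\<close>, while each single
  inequality is linear and hence passes to limits.\<close>

lemma geo_mean_pd_le_arith:
  assumes A: "pos_def A" and B: "pos_semidef B" and \<alpha>: "0 < \<alpha>" "\<alpha> < 1" and s: "0 < s"
  shows "geo_mean_pd \<alpha> A B \<preceq> (\<alpha> * s powr (\<alpha> - 1)) *\<^sub>R B + ((1 - \<alpha>) * s powr \<alpha>) *\<^sub>R A"
proof -
  let ?Ah = "mat_powr A (1/2)"
  define C where "C = mat_powr A (-(1/2)) ** B ** mat_powr A (-(1/2))"
  have C: "pos_semidef C" unfolding C_def by (intro pos_semidef_congruence hermitian_mat_powr B)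
  note hC = pos_semidef_hermitian[OF C]
  have "mat_powr C \<alpha> \<preceq> fun_calc (\<lambda>t. (\<alpha> * s powr (\<alpha> - 1)) * t + (1 - \<alpha>) * s powr \<alpha>) C"
    unfolding mat_powr_def
    by (intro fun_calc_mono powr_le_tangent s \<alpha> pos_semidef_eigenvalue_nonneg[OF C])
  also have "fun_calc (\<lambda>t. (\<alpha> * s powr (\<alpha> - 1)) * t + (1 - \<alpha>) * s powr \<alpha>) C
      = (\<alpha> * s powr (\<alpha> - 1)) *\<^sub>R C + ((1 - \<alpha>) * s powr \<alpha>) *\<^sub>R mat 1"
    by (simp only: fun_calc_add[OF hC] fun_calc_const[OF hC] fun_calc_scaleR[OF hC] fun_calc_id[OF hC])
  finally have "geo_mean_pd \<alpha> A B \<preceq>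
      ?Ah ** ((\<alpha> * s powr (\<alpha> - 1)) *\<^sub>R C + ((1 - \<alpha>) * s powr \<alpha>) *\<^sub>R mat 1) ** ?Ah"
    unfolding geo_mean_pd_eq C_def[symmetric] by (intro loewner_le_congruence hermitian_mat_powr)
  also have "\<dots> = (\<alpha> * s powr (\<alpha> - 1)) *\<^sub>R B + ((1 - \<alpha>) * s powr \<alpha>) *\<^sub>R A"
    unfolding C_def
    by (simp add: matrix_eq matrix_vector_linear_simps mat_powr_half_cancel[OF A]
        mat_powr_half_square[OF pos_def_imp_pos_semidef[OF A]] flip: matrix_vector_mul_assoc)
  finally show ?thesis .
qed

lemma pos_semidef_orth_projection: "orth_projection P \<Longrightarrow> pos_semidef P"
  by (simp add: pos_semidef_def orth_projection_form) (simp add: orth_projection_def)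

text \<open>Put \<open>T = A\<^sup>-\<^sup>1\<^sup>/\<^sup>2 R A\<^sup>-\<^sup>1\<^sup>/\<^sup>2\<close>.
  From \<open>c R \<le> A\<close> the eigenvalues of \<open>T\<close> are at most
  \<open>1/c\<close>, hence \<open>T\<^sup>\<alpha> \<ge> c\<^sup>1\<^sup>-\<^sup>\<alpha>
  T\<close>; from \<open>R \<le> B\<close> and Loewner-Heinz the middle factor of the mean
  dominates \<open>T\<^sup>\<alpha>\<close>. Conjugating by
  \<open>A\<^sup>1\<^sup>/\<^sup>2\<close> turns \<open>T\<close> back into \<open>R\<close>.
  Working with \<open>T\<close> avoids means of two singular matrices.\<close>

lemma geo_mean_pd_ge_projection:
  assumes A: "pos_def A" and B: "pos_semidef B" and R: "orth_projection R"
    and \<alpha>: "0 < \<alpha>" "\<alpha> < 1" and c: "0 < c"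
    and RA: "c *\<^sub>R R \<preceq> A" and RB: "R \<preceq> B"
  shows "c powr (1 - \<alpha>) *\<^sub>R R \<preceq> geo_mean_pd \<alpha> A B"
proof -
  let ?Ah = "mat_powr A (1/2)" and ?Ai = "mat_powr A (-(1/2))"
  define C where "C = ?Ai ** B ** ?Ai"
  define T where "T = ?Ai ** R ** ?Ai"
  have C: "pos_semidef C" and T: "pos_semidef T" unfolding C_def T_def
    by (intro pos_semidef_congruence hermitian_mat_powr B pos_semidef_orth_projection R)+
  note hT = pos_semidef_hermitian[OF T]
  have "?Ai ** (c *\<^sub>R R) ** ?Ai \<preceq> ?Ai ** A ** ?Ai"
    by (intro loewner_le_congruence RA hermitian_mat_powr)
  moreover have "?Ai *v (A *v (?Ai *v x)) = x" for x
    using mat_powr_half_square[OF pos_def_imp_pos_semidef[OF A], of "?Ai *v x"]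
      mat_powr_half_cancel[OF A] by metis
  ultimately have cT: "c * (x \<bullet> (T *v x)) \<le> x \<bullet> x" for x
    unfolding loewner_le_def T_def
    by (simp add: matrix_vector_linear_simps flip: matrix_vector_mul_assoc)
  have "c powr (1 - \<alpha>) * t \<le> t powr \<alpha>" if t: "t \<in> eigenvalues T" for t
  proof (cases "t = 0")
    case False
    obtain x where x: "x \<noteq> 0" "T *v x = t *\<^sub>R x" using t by (auto simp: eigenvalues_def)
    have t0: "0 < t" using pos_semidef_eigenvalue_nonneg[OF T t] False by simp
    have "c * t * (x \<bullet> x) \<le> 1 * (x \<bullet> x)" using cT[of x] by (simp add: x)
    then have ct: "c * t \<le> 1" using x(1) by (simp only: mult_le_cancel_right) auto
    have "c powr (1 - \<alpha>) * t = (c * t) powr (1 - \<alpha>) * t powr \<alpha>"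
      using t0 c by (simp add: powr_mult mult.assoc flip: powr_add)
    also have "\<dots> \<le> 1 * t powr \<alpha>"
      using ct t0 c \<alpha> by (intro mult_right_mono powr_le1) auto
    finally show ?thesis by simp
  qed simp
  then have "fun_calc (\<lambda>t. c powr (1 - \<alpha>) * t) T \<preceq> mat_powr T \<alpha>"
    unfolding mat_powr_def by (rule fun_calc_mono)
  moreover have "mat_powr T \<alpha> \<preceq> mat_powr C \<alpha>"
    using \<alpha> unfolding C_def T_def
    by (intro loewner_heinz loewner_le_congruence C[unfolded C_def] T[unfolded T_def] RB hermitian_mat_powr) auto
  ultimately have "c powr (1 - \<alpha>) *\<^sub>R T \<preceq> mat_powr C \<alpha>"
    using loewner_le_trans by (simp add: fun_calc_scaleR[OF hT] fun_calc_id[OF hT])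
  then have "?Ah ** (c powr (1 - \<alpha>) *\<^sub>R T) ** ?Ah \<preceq> geo_mean_pd \<alpha> A B"
    unfolding geo_mean_pd_eq C_def[symmetric] by (intro loewner_le_congruence hermitian_mat_powr)
  also have "?Ah ** (c powr (1 - \<alpha>) *\<^sub>R T) ** ?Ah = c powr (1 - \<alpha>) *\<^sub>R R"
    unfolding T_def by (simp add: matrix_eq matrix_vector_linear_simps mat_powr_half_cancel[OF A]
        flip: matrix_vector_mul_assoc)
  finally show ?thesis .
qed

subsection \<open>Positive semidefinite arguments\<close>

lemma tendsto_at_right_0_of_mono_nonneg:
  fixes g :: "real \<Rightarrow> real"
  assumes mono: "\<And>x y. 0 < x \<Longrightarrow> x \<le> y \<Longrightarrow> g x \<le> g y" and nn: "\<And>x. 0 < x \<Longrightarrow> 0 \<le> g x"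
  shows "(g \<longlongrightarrow> Inf (g ` {0<..})) (at_right 0)"
proof (rule order_tendstoI)
  have bdd: "bdd_below (g ` {0<..})" using nn by (auto intro!: bdd_belowI)
  have pos: "\<forall>\<^sub>F x in at_right (0::real). 0 < x" by (rule eventually_at_right_less)
  fix l assume l: "l < Inf (g ` {0<..})"
  show "\<forall>\<^sub>F x in at_right 0. l < g x"
    using pos
  proof eventually_elim
    case (elim x)
    then have "Inf (g ` {0<..}) \<le> g x" by (intro cInf_lower bdd) auto
    with l show ?case by simp
  qed
next
  fix l assume "Inf (g ` {0<..}) < l"
  then obtain x where x: "0 < x" "g x < l"
    using cInf_lessD[of "g ` {0<..}" l] by auto
  have "\<forall>\<^sub>F y in at_right 0. y < x" using x(1) by (auto simp: eventually_at_right_field)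
  with eventually_at_right_less[of 0] show "\<forall>\<^sub>F y in at_right 0. g y < l"
  proof eventually_elim
    case (elim y)
    then have "g y \<le> g x" by (intro mono) auto
    with x(2) show ?case by simp
  qed
qed

text \<open>The regularised means decrease as \<open>\<epsilon>\<close> decreases to 0 and are nonnegative,
  so their quadratic forms converge; this is what gives the \<open>Lim\<close> in the definition
  of the mean its meaning.\<close>

lemma geo_mean_limit:
  assumes A: "pos_semidef A" and B: "pos_semidef B" and \<alpha>: "0 < \<alpha>" "\<alpha> < 1" and "\<not> pos_def A"
  shows "((\<lambda>\<epsilon>::real. geo_mean_pd \<alpha> (A + \<epsilon> *\<^sub>R mat 1) (B + \<epsilon> *\<^sub>R mat 1)) \<longlongrightarrow> geo_mean \<alpha> A B) (at_right 0)"
    (is "(?f \<longlongrightarrow> _) _")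
proof -
  have mono: "?f \<delta> \<preceq> ?f \<epsilon>" if "0 < \<delta>" "\<delta> \<le> \<epsilon>" for \<delta> \<epsilon>
    using that \<alpha>
    by (intro geo_mean_pd_mono pos_def_add_scaleR_mat_1 A B)
      (auto simp: loewner_le_def matrix_vector_linear_simps inner_add intro: mult_right_mono)
  have "\<exists>L. (?f \<longlongrightarrow> L) (at_right 0)"
  proof (rule convergent_of_forms)
    show "\<forall>\<^sub>F \<epsilon> in at_right 0. hermitian (?f \<epsilon>)"
      by (intro always_eventually allI pos_semidef_hermitian pos_semidef_geo_mean_pd)
    fix x show "\<exists>l. ((\<lambda>\<epsilon>. x \<bullet> (?f \<epsilon> *v x)) \<longlongrightarrow> l) (at_right 0)"
    proof (rule exI, rule tendsto_at_right_0_of_mono_nonneg)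
      show "x \<bullet> (?f \<delta> *v x) \<le> x \<bullet> (?f \<epsilon> *v x)" if "0 < \<delta>" "\<delta> \<le> \<epsilon>" for \<delta> \<epsilon>
        using that by (intro loewner_leD mono)
      show "0 \<le> x \<bullet> (?f \<epsilon> *v x)" for \<epsilon>
        using pos_semidef_geo_mean_pd[of \<alpha>] unfolding pos_semidef_def by blast
    qed
  qed
  then show ?thesis
    unfolding geo_mean_def using assms(5) tendsto_Lim[of "at_right (0::real)" ?f] by auto
qed

lemma pos_semidef_geo_mean:
  assumes A: "pos_semidef A" and B: "pos_semidef B" and \<alpha>: "0 < \<alpha>" "\<alpha> < 1"
  shows "pos_semidef (geo_mean \<alpha> A B)"
proof (cases "pos_def A")
  case True
  then show ?thesis by (simp add: geo_mean_def pos_semidef_geo_mean_pd)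
next
  case False
  let ?f = "\<lambda>\<epsilon>::real. geo_mean_pd \<alpha> (A + \<epsilon> *\<^sub>R mat 1) (B + \<epsilon> *\<^sub>R mat 1)"
  note lim = geo_mean_limit[OF A B \<alpha> False]
  have psd: "\<forall>\<^sub>F \<epsilon> in at_right 0. pos_semidef (?f \<epsilon>)"
    by (intro always_eventually allI pos_semidef_geo_mean_pd)
  have "hermitian (geo_mean \<alpha> A B)"
    by (rule hermitian_limit[OF _ _ lim]) (use psd in \<open>auto elim: eventually_mono simp: pos_semidef_def\<close>)
  moreover have "0 \<le> x \<bullet> (geo_mean \<alpha> A B *v x)" for x
    by (rule tendsto_lowerbound[OF tendsto_inner_matrix_vector[OF lim]])
      (use psd in \<open>auto elim: eventually_mono simp: pos_semidef_def\<close>)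
  ultimately show ?thesis by (simp add: pos_semidef_def)
qed

lemma geo_mean_le_arith:
  assumes A: "pos_semidef A" and B: "pos_semidef B" and \<alpha>: "0 < \<alpha>" "\<alpha> < 1" and s: "0 < s"
  shows "geo_mean \<alpha> A B \<preceq> (\<alpha> * s powr (\<alpha> - 1)) *\<^sub>R B + ((1 - \<alpha>) * s powr \<alpha>) *\<^sub>R A"
proof (cases "pos_def A")
  case True
  then show ?thesis by (simp add: geo_mean_def geo_mean_pd_le_arith B \<alpha> s)
next
  case False
  let ?b = "\<alpha> * s powr (\<alpha> - 1)" and ?a = "(1 - \<alpha>) * s powr \<alpha>"
  let ?rhs = "\<lambda>\<epsilon>::real. ?b *\<^sub>R (B + \<epsilon> *\<^sub>R mat 1) + ?a *\<^sub>R (A + \<epsilon> *\<^sub>R mat 1)"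
  note lim = geo_mean_limit[OF A B \<alpha> False]
  have "(?rhs \<longlongrightarrow> ?b *\<^sub>R (B + 0 *\<^sub>R mat 1) + ?a *\<^sub>R (A + 0 *\<^sub>R mat 1)) (at_right 0)"
    by (intro tendsto_intros)
  then have rhs: "(?rhs \<longlongrightarrow> ?b *\<^sub>R B + ?a *\<^sub>R A) (at_right 0)" by simp
  show ?thesis unfolding loewner_le_def
  proof
    fix x
    show "x \<bullet> (geo_mean \<alpha> A B *v x) \<le> x \<bullet> ((?b *\<^sub>R B + ?a *\<^sub>R A) *v x)"
    proof (rule tendsto_le[OF _ tendsto_inner_matrix_vector[OF rhs] tendsto_inner_matrix_vector[OF lim]])
      show "\<forall>\<^sub>F \<epsilon> in at_right 0. x \<bullet> (geo_mean_pd \<alpha> (A + \<epsilon> *\<^sub>R mat 1) (B + \<epsilon> *\<^sub>R mat 1) *v x)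
          \<le> x \<bullet> (?rhs \<epsilon> *v x)"
        using eventually_at_right_less[of 0]
      proof eventually_elim
        case (elim \<epsilon>)
        then show ?case
          by (intro loewner_leD geo_mean_pd_le_arith pos_def_add_scaleR_mat_1
              pos_def_imp_pos_semidef[OF pos_def_add_scaleR_mat_1] A B \<alpha> s)
      qed
    qed simp
  qed
qed

lemma geo_mean_ge_projection:
  assumes A: "pos_semidef A" and B: "pos_semidef B" and R: "orth_projection R"
    and \<alpha>: "0 < \<alpha>" "\<alpha> < 1" and c: "0 < c"
    and RA: "c *\<^sub>R R \<preceq> A" and RB: "R \<preceq> B"
  shows "c powr (1 - \<alpha>) *\<^sub>R R \<preceq> geo_mean \<alpha> A B"
proof (cases "pos_def A")
  case True
  then show ?thesis unfolding geo_mean_def using geo_mean_pd_ge_projection[OF True B R \<alpha> c RA RB] by simp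
next
  case False
  note lim = geo_mean_limit[OF A B \<alpha> False]
  show ?thesis unfolding loewner_le_def
  proof
    fix x
    show "x \<bullet> ((c powr (1 - \<alpha>) *\<^sub>R R) *v x) \<le> x \<bullet> (geo_mean \<alpha> A B *v x)"
    proof (rule tendsto_lowerbound[OF tendsto_inner_matrix_vector[OF lim]])
      show "\<forall>\<^sub>F \<epsilon> in at_right 0. x \<bullet> ((c powr (1 - \<alpha>) *\<^sub>R R) *v x)
          \<le> x \<bullet> (geo_mean_pd \<alpha> (A + \<epsilon> *\<^sub>R mat 1) (B + \<epsilon> *\<^sub>R mat 1) *v x)"
        using eventually_at_right_less[of 0]
      proof eventually_elim
        case (elim \<epsilon>)
        have le: "M \<preceq> M + \<epsilon> *\<^sub>R mat 1" for M :: "complex^'n^'n"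
          using elim by (simp add: loewner_le_def matrix_vector_linear_simps inner_add)
        show ?case
          by (intro loewner_leD geo_mean_pd_ge_projection pos_def_add_scaleR_mat_1
              pos_def_imp_pos_semidef[OF pos_def_add_scaleR_mat_1] A B R \<alpha> c elim
              loewner_le_trans[OF RA le] loewner_le_trans[OF RB le])
      qed
    qed simp
  qed
qed

section \<open>Families and flags of orthogonal projections\<close>

definition orthogonal_projections :: "'k set \<Rightarrow> ('k \<Rightarrow> complex^'n^'n) \<Rightarrow> bool" where
  "orthogonal_projections S Q \<longleftrightarrow> finite S \<and> (\<forall>k\<in>S. orth_projection (Q k)) \<and>
     (\<forall>j\<in>S. \<forall>k\<in>S. j \<noteq> k \<longrightarrow> (\<forall>x. Q j *v (Q k *v x) = 0))"

lemma orthogonal_projections_apply: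
  assumes Q: "orthogonal_projections S Q" and j: "j \<in> S"
  shows "Q j *v (\<Sum>k\<in>S. c k *\<^sub>R (Q k *v x)) = c j *\<^sub>R (Q j *v x)"
proof -
  have "Q j *v (\<Sum>k\<in>S. c k *\<^sub>R (Q k *v x)) = (\<Sum>k\<in>S. c k *\<^sub>R (Q j *v (Q k *v x)))"
    by (simp add: linear_sum[OF linear_matrix_vector_mult] matrix_vector_linear_simps)
  also have "\<dots> = (\<Sum>k\<in>S. if k = j then c j *\<^sub>R (Q j *v x) else 0)"
    using Q j by (intro sum.cong) (auto simp: orthogonal_projections_def orth_projection_idem)
  also have "\<dots> = c j *\<^sub>R (Q j *v x)" using Q j by (simp add: orthogonal_projections_def)
  finally show ?thesis .
qed

lemma orthogonal_projections_sum_apply: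
  assumes Q: "orthogonal_projections S Q" and j: "j \<in> S"
  shows "(\<Sum>k\<in>S. c k *\<^sub>R Q k) *v (Q j *v x) = c j *\<^sub>R (Q j *v x)"
proof -
  have "(\<Sum>k\<in>S. c k *\<^sub>R Q k) *v (Q j *v x) = (\<Sum>k\<in>S. if k = j then c j *\<^sub>R (Q j *v x) else 0)"
    unfolding matrix_vector_linear_simps
    using Q j by (intro sum.cong) (auto simp: orthogonal_projections_def orth_projection_idem)
  also have "\<dots> = c j *\<^sub>R (Q j *v x)" using Q j by (simp add: orthogonal_projections_def)
  finally show ?thesis .
qed

lemma orthogonal_projections_form:
  assumes "orthogonal_projections S Q"
  shows "x \<bullet> ((\<Sum>k\<in>S. c k *\<^sub>R Q k) *v x) = (\<Sum>k\<in>S. c k * (norm (Q k *v x))\<^sup>2)"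
  using assms
  by (simp add: matrix_vector_linear_simps inner_sum_right orthogonal_projections_def orth_projection_form)

lemma hermitian_sum_projections:
  "orthogonal_projections S Q \<Longrightarrow> hermitian (\<Sum>k\<in>S. c k *\<^sub>R Q k)"
  by (intro hermitian_sum hermitian_scaleR) (simp add: orthogonal_projections_def orth_projection_def)

lemma orth_projection_sum:
  assumes Q: "orthogonal_projections S Q"
  shows "orth_projection (\<Sum>k\<in>S. Q k)"
proof -
  have "(\<Sum>k\<in>S. Q k) *v ((\<Sum>k\<in>S. Q k) *v x) = (\<Sum>k\<in>S. Q k) *v x" for x
  proof -
    have "(\<Sum>k\<in>S. Q k) *v ((\<Sum>k\<in>S. Q k) *v x) = (\<Sum>j\<in>S. Q j *v (\<Sum>k\<in>S. Q k *v x))"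
      by (simp only: matrix_vector_mult_sum_left)
    also have "\<dots> = (\<Sum>j\<in>S. Q j *v x)"
      using orthogonal_projections_apply[OF Q, where c = "\<lambda>_. 1"] by (intro sum.cong) auto
    finally show ?thesis by (simp only: matrix_vector_mult_sum_left)
  qed
  moreover have "hermitian (\<Sum>k\<in>S. Q k)"
    using hermitian_sum_projections[OF Q, of "\<lambda>_. 1"] by simp
  ultimately show ?thesis
    by (simp add: orth_projection_def matrix_eq flip: matrix_vector_mul_assoc)
qed

lemma orthogonal_projections_subset:
  "orthogonal_projections S Q \<Longrightarrow> T \<subseteq> S \<Longrightarrow> orthogonal_projections T Q"
  unfolding orthogonal_projections_def by (meson finite_subset subset_iff)

text \<open>The summands need not be spectral projections: coefficients may repeat and \<open>Q k\<close>
  may vanish. This is what allows roots of \<open>\<Sum>k. c\<^sub>k Q\<^sub>k\<close> to be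
  taken coefficientwise.\<close>

lemma fun_calc_sum_projections:
  assumes Q: "orthogonal_projections S Q" and one: "(\<Sum>k\<in>S. Q k) = mat 1"
  shows "fun_calc f (\<Sum>k\<in>S. c k *\<^sub>R Q k) = (\<Sum>k\<in>S. f (c k) *\<^sub>R Q k)"
proof -
  let ?M = "\<Sum>k\<in>S. c k *\<^sub>R Q k"
  have "fun_calc f ?M *v x = (\<Sum>k\<in>S. f (c k) *\<^sub>R Q k) *v x" for x
  proof -
    have "fun_calc f ?M *v x = fun_calc f ?M *v (\<Sum>k\<in>S. Q k *v x)"
      using one by (simp flip: matrix_vector_mult_sum_left)
    also have "\<dots> = (\<Sum>k\<in>S. fun_calc f ?M *v (Q k *v x))"
      by (rule linear_sum[OF linear_matrix_vector_mult])
    also have "\<dots> = (\<Sum>k\<in>S. f (c k) *\<^sub>R (Q k *v x))"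
      by (intro sum.cong refl fun_calc_eigenvector hermitian_sum_projections[OF Q]
          orthogonal_projections_sum_apply[OF Q])
    finally show ?thesis by (simp only: matrix_vector_linear_simps)
  qed
  then show ?thesis by (simp add: matrix_eq)
qed

lemma orth_projection_mat_1: "orth_projection (mat 1)"
  by (simp add: orth_projection_def hermitian_mat_1)

lemma orth_projection_complement: "orth_projection P \<Longrightarrow> orth_projection (mat 1 - P)"
  by (simp add: orth_projection_def hermitian_mat_1 hermitian_diff matrix_eq orth_projection_idem
      matrix_vector_linear_simps flip: matrix_vector_mul_assoc)

lemma norm_orth_projection_le:
  assumes "orth_projection P"
  shows "norm (P *v x) \<le> norm x"
proof (rule power2_le_imp_le[OF _ norm_ge_zero])
  have "(norm (x - P *v x))\<^sup>2 = (norm x)\<^sup>2 - (norm (P *v x))\<^sup>2"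
    using orth_projection_form[OF orth_projection_complement[OF assms], of x] orth_projection_form[OF assms, of x]
    by (simp add: matrix_vector_linear_simps inner_diff dot_square_norm)
  then show "(norm (P *v x))\<^sup>2 \<le> (norm x)\<^sup>2" by (smt (verit) zero_le_power2)
qed

lemma orth_projection_le_of_absorb:
  assumes P: "orth_projection P" and P': "orth_projection P'" and "\<And>x. P' *v (P *v x) = P *v x"
  shows "P \<preceq> P'"
  unfolding loewner_le_def orth_projection_form[OF P] orth_projection_form[OF P']
proof
  fix x
  have "norm (P *v x) = norm (P *v (P' *v x))"
    by (simp add: orth_projection_absorb_commute[OF assms])
  also have "\<dots> \<le> norm (P' *v x)" by (rule norm_orth_projection_le[OF P])
  finally show "(norm (P *v x))\<^sup>2 \<le> (norm (P' *v x))\<^sup>2" by (simp add: power_mono)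
qed

subsection \<open>Flags\<close>

text \<open>For an increasing chain of projections the increments are projections with orthogonal ranges. At
  \<open>k = 0\<close> truncated subtraction gives the increment 0, which is why only positive
  indices occur.\<close>

lemma projection_flag:
  fixes R :: "nat \<Rightarrow> complex^'n^'n"
  assumes R: "\<And>k. k \<le> n \<Longrightarrow> orth_projection (R k)"
    and absorb: "\<And>j k x. j \<le> k \<Longrightarrow> k \<le> n \<Longrightarrow> R k *v (R j *v x) = R j *v x"
  defines "Q \<equiv> \<lambda>k. R k - R (k - 1)"
  shows orthogonal_projections_flag: "orthogonal_projections {1..n} Q"
    and flag_increment_le: "\<And>k. k \<in> {1..n} \<Longrightarrow> Q k \<preceq> R k"
    and flag_increment_orthogonal: "\<And>k x. k \<in> {1..n} \<Longrightarrow> R (k - 1) *v (Q k *v x) = 0"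
proof -
  have absorb': "R j *v (R k *v x) = R j *v x" if "j \<le> k" "k \<le> n" for j k x
    using that by (intro orth_projection_absorb_commute R absorb) auto
  have herm: "hermitian (Q k)" if "k \<in> {1..n}" for k
    unfolding Q_def using that R[of k] R[of "k - 1"]
    by (intro hermitian_diff) (auto simp: orth_projection_def)
  have idem: "Q k *v (Q k *v x) = Q k *v x" if "k \<in> {1..n}" for k x
    using that unfolding Q_def by (auto simp: matrix_vector_linear_simps absorb absorb')
  have proj: "orth_projection (Q k)" if "k \<in> {1..n}" for k
    using herm[OF that] idem[OF that] by (simp add: orth_projection_def matrix_eq flip: matrix_vector_mul_assoc)
  have zero: "Q j *v (Q k *v x) = 0" if "j < k" "j \<in> {1..n}" "k \<in> {1..n}" for j k x
    using that unfolding Q_def by (auto simp: matrix_vector_linear_simps absorb absorb')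
  have zero': "Q k *v (Q j *v x) = 0" if "j < k" "j \<in> {1..n}" "k \<in> {1..n}" for j k x
    using that unfolding Q_def by (auto simp: matrix_vector_linear_simps absorb absorb')
  show "orthogonal_projections {1..n} Q"
    unfolding orthogonal_projections_def using proj zero zero' by (metis finite_atLeastAtMost nat_neq_iff)
  show "Q k \<preceq> R k" if "k \<in> {1..n}" for k
    using that by (intro orth_projection_le_of_absorb proj R) (auto simp: Q_def matrix_vector_linear_simps absorb)
  show "R (k - 1) *v (Q k *v x) = 0" if "k \<in> {1..n}" for k x
    using that by (auto simp: Q_def matrix_vector_linear_simps absorb absorb')
qed

lemma sum_flag_increments:
  fixes R :: "nat \<Rightarrow> 'a::ab_group_add"
  shows "(\<Sum>k=1..n. R k - R (k - 1)) = R n - R 0"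
  by (induction n) auto

subsection \<open>Meets\<close>

lemma orth_projection_meet: "orth_projection (N \<sqinter>\<^sub>p E)"
  unfolding proj_meet_def
  by (intro orth_projection_proj_onto vec.subspace_inter complex_subspace_mat_ran)

lemma meet_fix_iff:
  assumes "orth_projection N" "orth_projection E"
  shows "(N \<sqinter>\<^sub>p E) *v x = x \<longleftrightarrow> N *v x = x \<and> E *v x = x"
proof -
  have "mat_ran (N \<sqinter>\<^sub>p E) = mat_ran N \<inter> mat_ran E"
    unfolding proj_meet_def
    by (intro mat_ran_proj_onto vec.subspace_inter complex_subspace_mat_ran)
  then show ?thesis
    using orth_projection_mem_ran[OF orth_projection_meet, of x N E]
      orth_projection_mem_ran[OF assms(1), of x] orth_projection_mem_ran[OF assms(2), of x] by blast
qed

lemma meet_absorb: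
  assumes "orth_projection N" "orth_projection E"
  shows "N *v ((N \<sqinter>\<^sub>p E) *v x) = (N \<sqinter>\<^sub>p E) *v x" "E *v ((N \<sqinter>\<^sub>p E) *v x) = (N \<sqinter>\<^sub>p E) *v x"
  using meet_fix_iff[OF assms] orth_projection_idem[OF orth_projection_meet] by blast+

text \<open>The orthogonal complement of \<open>ran N \<inter> ran E\<close> is \<open>ker N + ker
  E\<close>: a vector orthogonal to both kernels is fixed by both projections, and in finite
  dimension every subspace is its own double complement.\<close>

lemma kernels_decomposition:
  fixes N E :: "complex^'n^'n"
  assumes N: "orth_projection N" and E: "orth_projection E" and v: "(N \<sqinter>\<^sub>p E) *v v = 0"
  shows "\<exists>x y. v = x + y \<and> N *v x = 0 \<and> E *v y = 0"
proof -
  define W where "W = {x + y |x y. x \<in> {x. N *v x = 0} \<and> y \<in> {y. E *v y = 0}}"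
  have W: "subspace W"
    unfolding W_def by (intro subspace_sums linear_subspace_kernel linear_matrix_vector_mult)
  have fix1: "P *v w = w" if P: "orth_projection P" and w: "w \<in> W\<^sup>\<bottom>" and sub: "\<And>x. P *v x = 0 \<Longrightarrow> x \<in> W" for P w
  proof -
    have "P *v (w - P *v w) = 0" by (simp add: matrix_vector_linear_simps orth_projection_idem[OF P])
    then have "(w - P *v w) \<bullet> w = 0" using w sub by (simp add: orthogonal_comp_def orthogonal_def)
    then have "w \<bullet> ((mat 1 - P) *v w) = 0" by (simp add: matrix_vector_linear_simps inner_commute)
    then have "(mat 1 - P) *v w = 0"
      unfolding orth_projection_form[OF orth_projection_complement[OF P]] by simp
    then show ?thesis by (simp add: matrix_vector_linear_simps)
  qed
  have kerN: "x \<in> W" if "N *v x = 0" for x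
  proof -
    have "x = x + 0 \<and> x \<in> {x. N *v x = 0} \<and> 0 \<in> {y. E *v y = 0}" using that by simp
    then show ?thesis unfolding W_def by blast
  qed
  have kerE: "x \<in> W" if "E *v x = 0" for x
  proof -
    have "x = 0 + x \<and> 0 \<in> {x. N *v x = 0} \<and> x \<in> {y. E *v y = 0}" using that by simp
    then show ?thesis unfolding W_def by blast
  qed
  have "orthogonal w v" if w: "w \<in> W\<^sup>\<bottom>" for w
  proof -
    have "(N \<sqinter>\<^sub>p E) *v w = w"
      unfolding meet_fix_iff[OF N E] using fix1[OF N w kerN] fix1[OF E w kerE] by blast
    then have "w \<bullet> v = w \<bullet> ((N \<sqinter>\<^sub>p E) *v v)"
      using orth_projection_inner[OF orth_projection_meet, of N E w v] by simp
    then show ?thesis by (simp add: v orthogonal_def)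
  qed
  then have "v \<in> W\<^sup>\<bottom>\<^sup>\<bottom>" by (simp add: orthogonal_comp_def[of "W\<^sup>\<bottom>"])
  then show ?thesis unfolding orthogonal_comp_self[OF W] by (auto simp: W_def)
qed

text \<open>Choosing the decomposition once for each projected basis vector and extending linearly yields a
  norm bound uniform in \<open>v\<close>.\<close>

lemma kernels_decomposition_bounded:
  fixes N E :: "complex^'n^'n"
  assumes N: "orth_projection N" and E: "orth_projection E"
  shows "\<exists>C\<ge>0. \<forall>v. (N \<sqinter>\<^sub>p E) *v v = 0 \<longrightarrow>
    (\<exists>x y. v = x + y \<and> N *v x = 0 \<and> E *v y = 0 \<and> norm x \<le> C * norm v)"
proof -
  let ?R = "N \<sqinter>\<^sub>p E"
  have "\<exists>x y. e - ?R *v e = x + y \<and> N *v x = 0 \<and> E *v y = 0" for e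
    by (rule kernels_decomposition[OF N E])
      (simp add: matrix_vector_linear_simps orth_projection_idem[OF orth_projection_meet])
  then obtain f g where fg: "\<And>e. e - ?R *v e = f e + g e" "\<And>e. N *v f e = 0" "\<And>e. E *v g e = 0"
    by metis
  define C where "C = (\<Sum>e\<in>Basis. norm (f e))"
  have "\<exists>x y. v = x + y \<and> N *v x = 0 \<and> E *v y = 0 \<and> norm x \<le> C * norm v" if v: "?R *v v = 0" for v
  proof (intro exI conjI)
    let ?x = "\<Sum>e\<in>Basis. (v \<bullet> e) *\<^sub>R f e" and ?y = "\<Sum>e\<in>Basis. (v \<bullet> e) *\<^sub>R g e"
    have "v = (\<Sum>e\<in>Basis. (v \<bullet> e) *\<^sub>R e) - ?R *v (\<Sum>e\<in>Basis. (v \<bullet> e) *\<^sub>R e)"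
      unfolding euclidean_representation by (simp add: v)
    also have "\<dots> = (\<Sum>e\<in>Basis. (v \<bullet> e) *\<^sub>R (e - ?R *v e))"
      by (simp add: linear_sum[OF linear_matrix_vector_mult] matrix_vector_linear_simps scaleR_diff_right sum_subtractf)
    also have "\<dots> = ?x + ?y" by (simp add: fg(1) scaleR_add_right sum.distrib)
    finally show "v = ?x + ?y" .
    show "N *v ?x = 0" "E *v ?y = 0"
      by (simp_all add: linear_sum[OF linear_matrix_vector_mult] matrix_vector_linear_simps fg)
    have "norm ?x \<le> (\<Sum>e\<in>Basis. norm ((v \<bullet> e) *\<^sub>R f e))" by (rule norm_sum)
    also have "\<dots> \<le> (\<Sum>e\<in>Basis. norm v * norm (f e))"
      by (intro sum_mono) (simp add: Basis_le_norm mult_right_mono)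
    also have "\<dots> = C * norm v" by (simp add: C_def sum_distrib_left mult.commute)
    finally show "norm ?x \<le> C * norm v" .
  qed
  moreover have "0 \<le> C" unfolding C_def by (intro sum_nonneg) auto
  ultimately show ?thesis by blast
qed

section \<open>Upper bound for the mean with a projection\<close>

text \<open>The bound becomes arbitrarily small as \<open>s\<close> tends to 0 if \<open>r > 0\<close>, and
  to infinity if \<open>r < 0\<close>.\<close>

lemma nonpos_of_le_all_powr:
  fixes q K r :: real
  assumes le: "\<And>s. 0 < s \<Longrightarrow> q \<le> s powr r * K" and "r \<noteq> 0"
  shows "q \<le> 0"
proof (rule ccontr)
  assume "\<not> q \<le> 0"
  then have q: "0 < q" by simp
  have "q \<le> K" using le[of 1] by simp
  with q have K: "0 < K" by simp
  have "q \<le> ((q / (2 * K)) powr (1 / r)) powr r * K" using q K by (intro le) simp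
  also have "\<dots> = q / 2" using q K assms(2) by (simp add: powr_powr)
  finally show False using q by simp
qed

lemma pos_semidef_form_add_le:
  assumes "pos_semidef G"
  shows "(x + y) \<bullet> (G *v (x + y)) \<le> 2 * (x \<bullet> (G *v x)) + 2 * (y \<bullet> (G *v y))"
proof -
  have "0 \<le> (x - y) \<bullet> (G *v (x - y))" using assms by (simp add: pos_semidef_def)
  then show ?thesis by (simp add: matrix_vector_linear_simps inner_add inner_diff)
qed

text \<open>A crude constant is enough, because only its \<open>p\<close>-th root enters the limit.\<close>

lemma pos_semidef_form_sum_le:
  assumes G: "pos_semidef G" and "finite S"
  shows "(\<Sum>k\<in>S. f k) \<bullet> (G *v (\<Sum>k\<in>S. f k)) \<le> 2 ^ card S * (\<Sum>k\<in>S. f k \<bullet> (G *v f k))"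
  using assms(2)
proof (induction S rule: finite_induct)
  case (insert k S)
  let ?q = "\<lambda>x. x \<bullet> (G *v x)"
  have nn: "0 \<le> ?q x" for x using G by (simp add: pos_semidef_def)
  have "?q (\<Sum>k\<in>insert k S. f k) \<le> 2 * ?q (f k) + 2 * ?q (\<Sum>k\<in>S. f k)"
    using insert pos_semidef_form_add_le[OF G, of "f k"] by simp
  also have "\<dots> \<le> 2 * (2 ^ card S * ?q (f k)) + 2 * (2 ^ card S * (\<Sum>k\<in>S. ?q (f k)))"
    using insert nn[of "f k"] by (intro add_mono mult_left_mono) (auto simp: mult_le_cancel_right1)
  also have "\<dots> = 2 ^ card (insert k S) * (\<Sum>k\<in>insert k S. ?q (f k))"
    using insert by (simp add: algebra_simps)
  finally show ?case .
qed simp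

text \<open>Since the form of \<open>E\<close> vanishes at \<open>y\<close>, letting the parameter of the
  arithmetic-geometric inequality tend to 0 shows that the form of the mean vanishes at
  \<open>y\<close>. At \<open>x\<close> the parameter \<open>s = 1/b\<close> balances the two
  terms; for \<open>b = 0\<close> it is sent to infinity instead.\<close>

lemma geo_mean_form_le:
  assumes A: "pos_semidef A" and E: "orth_projection E" and \<alpha>: "0 < \<alpha>" "\<alpha> < 1"
    and y: "E *v y = 0" and x: "x \<bullet> (A *v x) \<le> b * (norm x)\<^sup>2" and b: "0 \<le> b"
  shows "(x + y) \<bullet> (geo_mean \<alpha> A E *v (x + y)) \<le> 2 * b powr (1 - \<alpha>) * (norm x)\<^sup>2"
proof -
  let ?G = "geo_mean \<alpha> A E"
  note psdE = pos_semidef_orth_projection[OF E]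
  have arith: "z \<bullet> (?G *v z) \<le> (\<alpha> * s powr (\<alpha> - 1)) * (norm (E *v z))\<^sup>2 + ((1 - \<alpha>) * s powr \<alpha>) * (z \<bullet> (A *v z))"
    if "0 < s" for s z
    using loewner_leD[OF geo_mean_le_arith[OF A psdE \<alpha> that], of z]
    by (simp add: matrix_vector_linear_simps inner_add orth_projection_form[OF E])
  have "y \<bullet> (?G *v y) \<le> 0"
  proof (rule nonpos_of_le_all_powr)
    show "y \<bullet> (?G *v y) \<le> s powr \<alpha> * ((1 - \<alpha>) * (y \<bullet> (A *v y)))" if "0 < s" for s
      using arith[OF that, of y] by (simp add: y mult_ac)
  qed (use \<alpha> in simp)
  moreover have "x \<bullet> (?G *v x) \<le> b powr (1 - \<alpha>) * (norm x)\<^sup>2"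
  proof -
    have bound: "x \<bullet> (?G *v x) \<le> (\<alpha> * s powr (\<alpha> - 1)) * (norm x)\<^sup>2 + ((1 - \<alpha>) * s powr \<alpha>) * (b * (norm x)\<^sup>2)"
      if s: "0 < s" for s
    proof (rule order_trans[OF arith[OF s]], intro add_mono mult_left_mono)
      show "(norm (E *v x))\<^sup>2 \<le> (norm x)\<^sup>2" by (intro power_mono norm_orth_projection_le[OF E]) simp
    qed (use \<alpha> s x in auto)
    show ?thesis
    proof (cases "b = 0")
      case True
      have "x \<bullet> (?G *v x) \<le> 0"
      proof (rule nonpos_of_le_all_powr)
        show "x \<bullet> (?G *v x) \<le> s powr (\<alpha> - 1) * (\<alpha> * (norm x)\<^sup>2)" if "0 < s" for s
          using bound[OF that] True by (simp add: mult_ac)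
      qed (use \<alpha> in simp)
      then show ?thesis using True by simp
    next
      case False
      with b have b0: "0 < b" by simp
      have p1: "inverse b powr (\<alpha> - 1) = b powr (1 - \<alpha>)"
        using b0 by (simp add: inverse_powr flip: powr_minus)
      have "b powr (1 - \<alpha>) = b * inverse b powr \<alpha>"
        using b0 by (simp only: inverse_powr powr_diff) (simp add: divide_inverse)
      then show ?thesis using bound[of "inverse b"] b0 by (simp add: p1 algebra_simps)
    qed
  qed
  ultimately show ?thesis
    using pos_semidef_form_add_le[OF pos_semidef_geo_mean[OF A psdE \<alpha>], of x y] by simp
qed


section \<open>The limit\<close>

text \<open>The eigenvalue 0 contributes nothing to \<open>A\<^sup>p\<close>, as \<open>0 powr p =
  0\<close>; the remaining eigenvalues are enumerated injectively by \<open>a\<close>.\<close>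

lemma spectral_decomposition_projections:
  fixes A :: "complex^'n^'n"
  assumes A: "pos_semidef A" and dec: "spectral_decomposition A m a P"
  shows "orthogonal_projections {1..m} P"
    and "mat_powr A p = (\<Sum>k=1..m. (a k powr p) *\<^sub>R P k)"
proof -
  note herm = pos_semidef_hermitian[OF A]
  have decr: "a j < a i" if "1 \<le> i" "i < j" "j \<le> m" for i j
    using dec that unfolding spectral_decomposition_def by blast
  have vals: "a ` {1..m} = {t \<in> eigenvalues A. 0 < t}"
    and P: "\<And>k. k \<in> {1..m} \<Longrightarrow> P k = proj_onto (eigenspace A (a k))"
    using dec unfolding spectral_decomposition_def by blast+
  have neq: "a i \<noteq> a j" if "i \<in> {1..m}" "j \<in> {1..m}" "i \<noteq> j" for i j
    using decr[of i j] decr[of j i] that by (cases "i < j") auto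
  show "orthogonal_projections {1..m} P"
    unfolding orthogonal_projections_def
  proof (intro conjI ballI impI allI)
    show "P j *v (P k *v x) = 0" if "j \<in> {1..m}" "k \<in> {1..m}" "j \<noteq> k" for j k x
      unfolding P[OF that(1)] P[OF that(2)]
      by (rule eigenprojection_other[OF herm eigenprojection_eigenvector neq])
        (use that in auto)
  qed (simp_all add: P orth_projection_eigenprojection)
  have "mat_powr A p = (\<Sum>t\<in>a ` {1..m}. (t powr p) *\<^sub>R proj_onto (eigenspace A t))"
    unfolding mat_powr_def fun_calc_def vals
  proof (rule sum.mono_neutral_right[OF finite_eigenvalues[OF herm]])
    show "\<forall>t\<in>eigenvalues A - {t \<in> eigenvalues A. 0 < t}. (t powr p) *\<^sub>R proj_onto (eigenspace A t) = 0"
      using pos_semidef_eigenvalue_nonneg[OF A] by (auto simp: order.order_iff_strict)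
  qed auto
  also have "\<dots> = (\<Sum>k=1..m. (a k powr p) *\<^sub>R P k)"
  proof (subst sum.reindex)
    show "inj_on a {1..m}" by (rule inj_onI) (use neq in blast)
  qed (simp add: P)
  finally show "mat_powr A p = (\<Sum>k=1..m. (a k powr p) *\<^sub>R P k)" .
qed

text \<open>Taking \<open>p\<close>-th roots preserves the sandwich by Loewner-Heinz and turns its outer
  terms into \<open>c\<^sup>1\<^sup>/\<^sup>p D\<close> and \<open>K\<^sup>1\<^sup>/\<^sup>p
  D\<close> with \<open>D = \<Sum>k. d\<^sub>k Q\<^sub>k\<close>, both of which converge to
  \<open>D\<close>.\<close>

lemma tendsto_mat_powr_inverse_of_sandwich:
  fixes G :: "real \<Rightarrow> complex^'n^'n" and Q :: "'k \<Rightarrow> complex^'n^'n" and d :: "'k \<Rightarrow> real"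
  assumes Q: "orthogonal_projections S Q" and one: "(\<Sum>k\<in>S. Q k) = mat 1"
    and d: "\<And>k. k \<in> S \<Longrightarrow> 0 \<le> d k" and c: "0 < c" and K: "0 < K"
    and G: "\<And>p. 0 < p \<Longrightarrow> pos_semidef (G p)"
    and lower: "\<And>p. 0 < p \<Longrightarrow> c *\<^sub>R (\<Sum>k\<in>S. (d k powr p) *\<^sub>R Q k) \<preceq> G p"
    and upper: "\<And>p. 0 < p \<Longrightarrow> G p \<preceq> K *\<^sub>R (\<Sum>k\<in>S. (d k powr p) *\<^sub>R Q k)"
  shows "((\<lambda>p. mat_powr (G p) (1/p)) \<longlongrightarrow> (\<Sum>k\<in>S. d k *\<^sub>R Q k)) at_top"
proof -
  let ?D = "\<Sum>k\<in>S. d k *\<^sub>R Q k"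
  let ?H = "\<lambda>p. \<Sum>k\<in>S. (d k powr p) *\<^sub>R Q k"
  have scaled: "c *\<^sub>R ?H p = (\<Sum>k\<in>S. (c * d k powr p) *\<^sub>R Q k)" for c p
    by (simp add: scaleR_sum_right)
  have psd: "pos_semidef (c *\<^sub>R ?H p)" if "0 < c" for c p
    unfolding pos_semidef_def scaled orthogonal_projections_form[OF Q]
    using that by (auto intro!: hermitian_sum_projections[OF Q] sum_nonneg)
  have root: "mat_powr (c *\<^sub>R ?H p) (1/p) = (c powr (1/p)) *\<^sub>R ?D" if "0 < c" "0 < p" for c p
  proof -
    have "mat_powr (c *\<^sub>R ?H p) (1/p) = (\<Sum>k\<in>S. ((c * d k powr p) powr (1/p)) *\<^sub>R Q k)"
      unfolding mat_powr_def scaled by (rule fun_calc_sum_projections[OF Q one])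
    also have "\<dots> = (\<Sum>k\<in>S. (c powr (1/p) * d k) *\<^sub>R Q k)"
      using that d by (intro sum.cong refl) (simp add: powr_mult powr_powr)
    finally show ?thesis by (simp add: scaleR_sum_right)
  qed
  have form_lim: "((\<lambda>p. c powr (1/p) * q) \<longlongrightarrow> q) at_top" if "0 < c" for c q :: real
  proof -
    have "((\<lambda>p::real. 1 / p) \<longlongrightarrow> 0) at_top"
      by (intro tendsto_divide_0[OF tendsto_const] filterlim_at_top_imp_at_infinity filterlim_ident)
    then have "((\<lambda>p. c powr (1/p) * q) \<longlongrightarrow> c powr 0 * q) at_top"
      using that by (intro tendsto_mult tendsto_powr tendsto_const) auto
    then show ?thesis using that by simp
  qed
  show ?thesis
  proof (rule tendsto_hermitianI)
    show "\<forall>\<^sub>F p in at_top. hermitian (mat_powr (G p) (1/p))"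
      by (intro always_eventually allI hermitian_mat_powr)
    show "hermitian ?D" by (rule hermitian_sum_projections[OF Q])
    fix x
    have lb: "c powr (1/p) * (x \<bullet> (?D *v x)) \<le> x \<bullet> (mat_powr (G p) (1/p) *v x)" if "1 \<le> p" for p
    proof -
      have p: "0 < p" using that by simp
      have "mat_powr (c *\<^sub>R ?H p) (1/p) \<preceq> mat_powr (G p) (1/p)"
        using that by (intro loewner_heinz psd[OF c] G[OF p] lower[OF p]) simp_all
      from loewner_leD[OF this, of x] show ?thesis
        by (simp only: root[OF c p] matrix_vector_mult_scaleR_left inner_scaleR_right)
    qed
    have ub: "x \<bullet> (mat_powr (G p) (1/p) *v x) \<le> K powr (1/p) * (x \<bullet> (?D *v x))" if "1 \<le> p" for p
    proof -
      have p: "0 < p" using that by simp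
      have "mat_powr (G p) (1/p) \<preceq> mat_powr (K *\<^sub>R ?H p) (1/p)"
        using that by (intro loewner_heinz psd[OF K] G[OF p] upper[OF p]) simp_all
      from loewner_leD[OF this, of x] show ?thesis
        by (simp only: root[OF K p] matrix_vector_mult_scaleR_left inner_scaleR_right)
    qed
    show "((\<lambda>p. x \<bullet> (mat_powr (G p) (1/p) *v x)) \<longlongrightarrow> x \<bullet> (?D *v x)) at_top"
    proof (rule tendsto_sandwich[OF _ _ form_lim[OF c] form_lim[OF K]])
      show "\<forall>\<^sub>F p in at_top. c powr (1/p) * (x \<bullet> (?D *v x)) \<le> x \<bullet> (mat_powr (G p) (1/p) *v x)"
        using eventually_ge_at_top[of "1::real"] by eventually_elim (rule lb)
      show "\<forall>\<^sub>F p in at_top. x \<bullet> (mat_powr (G p) (1/p) *v x) \<le> K powr (1/p) * (x \<bullet> (?D *v x))"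
        using eventually_ge_at_top[of "1::real"] by eventually_elim (rule ub)
    qed
  qed simp
qed

theorem theorem3p6:
  fixes A E :: "complex^'n^'n"
    and P Q :: "nat \<Rightarrow> complex^'n^'n"
    and a :: "nat \<Rightarrow> real"
    and m :: nat
    and \<alpha> :: real
  assumes "0 < \<alpha>" and "\<alpha> < 1"
    and "pos_semidef A"
    and "spectral_decomposition A m a P"
    and "orth_projection E"
    and "Q 1 = P 1 \<sqinter>\<^sub>p E"
    and "\<And>k. 2 \<le> k \<Longrightarrow> k \<le> m \<Longrightarrow>
           Q k = (\<Sum>j=1..k. P j) \<sqinter>\<^sub>p E - (\<Sum>j=1..k-1. P j) \<sqinter>\<^sub>p E"
  shows "((\<lambda>p::real. mat_powr (geo_mean \<alpha> (mat_powr A p) E) (1/p))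
            \<longlongrightarrow> (\<Sum>k=1..m. a k powr (1 - \<alpha>) *\<^sub>R Q k)) at_top"
proof -
  note \<alpha> = assms(1,2) and A = assms(3) and dec = assms(4) and E = assms(5)
  note P = spectral_decomposition_projections(1)[OF A dec]
  note powr_A = spectral_decomposition_projections(2)[OF A dec]
  have decr: "a j \<le> a i" if "1 \<le> i" "i \<le> j" "j \<le> m" for i j
    using dec that unfolding spectral_decomposition_def by (cases "i = j") (auto simp: less_imp_le)
  have a_pos: "0 < a k" if "k \<in> {1..m}" for k
    using dec that unfolding spectral_decomposition_def by blast
  define N where "N k = (\<Sum>j=1..k. P j)" for k
  have N: "orth_projection (N k)" if "k \<le> m" for k
    unfolding N_def using that by (intro orth_projection_sum orthogonal_projections_subset[OF P]) auto
  have N_form: "(norm (N k *v x))\<^sup>2 = (\<Sum>j=1..k. (norm (P j *v x))\<^sup>2)" if "k \<le> m" for k x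
    using orthogonal_projections_form[OF orthogonal_projections_subset[OF P, of "{1..k}"], of x "\<lambda>_. 1"]
      orth_projection_form[OF N[OF that], of x] that by (simp add: N_def)
  have PN: "P j *v (N k *v x) = P j *v x" if "k \<le> m" "j \<in> {1..k}" for j k x
    using orthogonal_projections_apply[OF orthogonal_projections_subset[OF P, of "{1..k}"], of j "\<lambda>_. 1" x] that
    by (simp add: N_def matrix_vector_linear_simps)
  have N_absorb: "N k *v (N j *v x) = N j *v x" if "j \<le> k" "k \<le> m" for j k x
  proof -
    have "N k *v (P i *v x) = P i *v x" if "i \<in> {1..j}" for i
      using orthogonal_projections_sum_apply[OF orthogonal_projections_subset[OF P, of "{1..k}"],
          of i "\<lambda>_. 1" x] that \<open>j \<le> k\<close> \<open>k \<le> m\<close>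
      by (simp add: N_def)
    then show ?thesis
      unfolding N_def[of j] matrix_vector_mult_sum_left
      by (simp add: linear_sum[OF linear_matrix_vector_mult])
  qed
  \<comment> \<open>At \<open>m + 1\<close> the flag is completed by the identity; its last increment then covers the part
    where the limit is zero, so that the increments sum to the identity.\<close>
  define R where "R k = (if k \<le> m then N k \<sqinter>\<^sub>p E else mat 1)" for k
  have R: "orth_projection (R k)" for k
    by (simp add: R_def orth_projection_meet orth_projection_mat_1)
  have R_absorb: "R k *v (R j *v x) = R j *v x" if "j \<le> k" for j k x
  proof (cases "k \<le> m")
    case True
    note jE = meet_absorb[OF N E, of j]
    have "N k *v (R j *v x) = R j *v x"
      using N_absorb[OF that True, of "R j *v x"] jE(1)[of x] that True by (simp add: R_def)
    moreover have "E *v (R j *v x) = R j *v x"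
      using jE(2)[of x] that True by (simp add: R_def)
    ultimately show ?thesis
      using True meet_fix_iff[OF N[OF True] E, of "R j *v x"] by (simp add: R_def[of k])
  qed (simp add: R_def[of k])
  define Q' where "Q' k = R k - R (k - 1)" for k
  have Q': "orthogonal_projections {1..Suc m} Q'"
    and Q'_le: "\<And>k. k \<in> {1..Suc m} \<Longrightarrow> Q' k \<preceq> R k"
    and Q'_orth: "\<And>k x. k \<in> {1..Suc m} \<Longrightarrow> R (k - 1) *v (Q' k *v x) = 0"
    using projection_flag[of "Suc m" R, OF R R_absorb] unfolding Q'_def[abs_def] by blast+
  have R0: "R 0 = 0"
  proof -
    have "R 0 *v x = 0" for x
      using meet_absorb(1)[OF N E, of 0 x] by (simp add: R_def N_def)
    then show ?thesis by (simp add: matrix_eq)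
  qed
  have one: "(\<Sum>k\<in>{1..Suc m}. Q' k) = mat 1"
    unfolding Q'_def sum_flag_increments R0 by (simp add: R_def)
  have Q_eq: "Q k = Q' k" if "k \<in> {1..m}" for k
  proof (cases "k = 1")
    case True
    then show ?thesis using that assms(6) R0 by (simp add: Q'_def R_def N_def)
  next
    case False
    then have "2 \<le> k" "k \<le> m" "k - 1 \<le> m" using that by auto
    then show ?thesis using assms(7)[of k] by (simp only: Q'_def R_def N_def if_True)
  qed
  \<comment> \<open>The value 0 at \<open>m + 1\<close> bounds \<open>A\<^sup>p\<close> on the kernel of \<open>A\<close>, and \<open>0 powr _ = 0\<close> removes the extra
    term of the limit.\<close>
  define b where "b k = (if k \<le> m then a k else 0)" for k
  have b_nonneg: "0 \<le> b k" if "k \<in> {1..Suc m}" for k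
    using a_pos[of k] that by (auto simp: b_def less_imp_le)
  have D: "(\<Sum>k\<in>{1..Suc m}. (b k powr (1 - \<alpha>)) *\<^sub>R Q' k) = (\<Sum>k=1..m. a k powr (1 - \<alpha>) *\<^sub>R Q k)"
    by (simp add: b_def Q_eq)
  let ?G = "\<lambda>p. geo_mean \<alpha> (mat_powr A p) E"
  have G: "pos_semidef (?G p)" for p
    by (intro pos_semidef_geo_mean pos_semidef_mat_powr pos_semidef_orth_projection E \<alpha>)
  have pp: "(b k powr (1 - \<alpha>)) powr p = (b k powr p) powr (1 - \<alpha>)" for k p
    by (simp add: powr_powr mult.commute)
  \<comment> \<open>The range of \<open>R k\<close> lies in that of \<open>N k\<close>, where the eigenvalues of \<open>A\<close> are at least \<open>a k\<close>;
    on the kernel of \<open>N (k - 1)\<close>, in the next step, they are at most \<open>b k\<close>.\<close>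
  have A_lower: "(a k powr p) *\<^sub>R R k \<preceq> mat_powr A p" if k: "k \<in> {1..m}" and p: "0 < p" for k p
    unfolding loewner_le_def
  proof
    fix x
    have "R k \<preceq> N k"
      using k meet_absorb(1)[OF N E, of k] by (intro orth_projection_le_of_absorb R N) (auto simp: R_def)
    from loewner_leD[OF this, of x] have "(norm (R k *v x))\<^sup>2 \<le> (norm (N k *v x))\<^sup>2"
      using k by (simp only: orth_projection_form[OF R] orth_projection_form[OF N] atLeastAtMost_iff)
    then have "a k powr p * (norm (R k *v x))\<^sup>2 \<le> a k powr p * (norm (N k *v x))\<^sup>2"
      by (rule mult_left_mono) simp
    also have "\<dots> = (\<Sum>j=1..k. a k powr p * (norm (P j *v x))\<^sup>2)"
      using k by (simp add: N_form sum_distrib_left)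
    also have "\<dots> \<le> (\<Sum>j=1..k. a j powr p * (norm (P j *v x))\<^sup>2)"
      using k p a_pos[OF k] decr by (intro sum_mono mult_right_mono powr_mono2) auto
    also have "\<dots> \<le> (\<Sum>j=1..m. a j powr p * (norm (P j *v x))\<^sup>2)"
      using k by (intro sum_mono2) auto
    also have "\<dots> = x \<bullet> (mat_powr A p *v x)"
      unfolding powr_A by (rule orthogonal_projections_form[OF P, symmetric])
    finally show "x \<bullet> (((a k powr p) *\<^sub>R R k) *v x) \<le> x \<bullet> (mat_powr A p *v x)"
      by (simp add: matrix_vector_linear_simps orth_projection_form[OF R])
  qed
  have A_upper: "x \<bullet> (mat_powr A p *v x) \<le> b k powr p * (norm x)\<^sup>2"
    if k: "k \<in> {1..Suc m}" and p: "0 < p" and x: "N (k - 1) *v x = 0" for k p x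
  proof -
    have zero: "P j *v x = 0" if "j \<in> {1..k - 1}" for j
    proof -
      have "k - 1 \<le> m" using k by auto
      from PN[OF this that, of x] show ?thesis by (simp only: x matrix_vector_mult_0_right)
    qed
    have "x \<bullet> (mat_powr A p *v x) = (\<Sum>j=1..m. a j powr p * (norm (P j *v x))\<^sup>2)"
      unfolding powr_A by (rule orthogonal_projections_form[OF P])
    also have "\<dots> \<le> (\<Sum>j=1..m. b k powr p * (norm (P j *v x))\<^sup>2)"
    proof (rule sum_mono)
      fix j assume j: "j \<in> {1..m}"
      show "a j powr p * (norm (P j *v x))\<^sup>2 \<le> b k powr p * (norm (P j *v x))\<^sup>2"
      proof (cases "j < k")
        case True
        then show ?thesis using zero[of j] j by auto
      next
        case False
        then show ?thesis
          using j k p decr[of k j] a_pos[OF j] by (intro mult_right_mono powr_mono2) (auto simp: b_def)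
      qed
    qed
    also have "\<dots> = b k powr p * (norm (N m *v x))\<^sup>2" by (simp add: N_form sum_distrib_left)
    also have "\<dots> \<le> b k powr p * (norm x)\<^sup>2"
      by (intro mult_left_mono power_mono norm_orth_projection_le N) auto
    finally show ?thesis .
  qed
  have "\<exists>C\<ge>0. \<forall>v. R (k - 1) *v v = 0 \<longrightarrow>
      (\<exists>x y. v = x + y \<and> N (k - 1) *v x = 0 \<and> E *v y = 0 \<and> norm x \<le> C * norm v)"
    if "k \<in> {1..Suc m}" for k
  proof -
    have "k - 1 \<le> m" using that by auto
    then show ?thesis
      using kernels_decomposition_bounded[OF N E, of "k - 1"] by (simp only: R_def if_True)
  qed
  then obtain C where C: "\<And>k. k \<in> {1..Suc m} \<Longrightarrow> 0 \<le> C k"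
    and split: "\<And>k v. k \<in> {1..Suc m} \<Longrightarrow> R (k - 1) *v v = 0 \<Longrightarrow>
      \<exists>x y. v = x + y \<and> N (k - 1) *v x = 0 \<and> E *v y = 0 \<and> norm x \<le> C k * norm v"
    by metis
  have G_form: "v \<bullet> (?G p *v v) \<le> 2 * (C k)\<^sup>2 * ((b k powr (1 - \<alpha>)) powr p * (norm v)\<^sup>2)"
    if k: "k \<in> {1..Suc m}" and p: "0 < p" and v: "R (k - 1) *v v = 0" for k p v
  proof -
    obtain x y where xy: "v = x + y" "N (k - 1) *v x = 0" "E *v y = 0" "norm x \<le> C k * norm v"
      using split[OF k v] by blast
    have "v \<bullet> (?G p *v v) \<le> 2 * (b k powr p) powr (1 - \<alpha>) * (norm x)\<^sup>2"
      unfolding xy(1)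
      by (intro geo_mean_form_le pos_semidef_mat_powr E \<alpha> xy(3) A_upper[OF k p xy(2)]) simp
    also have "\<dots> \<le> 2 * (b k powr p) powr (1 - \<alpha>) * (C k * norm v)\<^sup>2"
      using xy(4) by (intro mult_left_mono power_mono) auto
    finally show ?thesis by (simp add: pp power_mult_distrib mult_ac)
  qed
  \<comment> \<open>The power of 2 comes from splitting a vector along the \<open>m + 1\<close> increments, and the summand 1
    keeps \<open>K\<close> positive.\<close>
  define K where "K = 2 ^ Suc m * (1 + (\<Sum>k\<in>{1..Suc m}. 2 * (C k)\<^sup>2))"
  have K: "0 < K" unfolding K_def by (intro mult_pos_pos add_pos_nonneg sum_nonneg) auto
  have "((\<lambda>p. mat_powr (?G p) (1/p)) \<longlongrightarrow> (\<Sum>k\<in>{1..Suc m}. (b k powr (1 - \<alpha>)) *\<^sub>R Q' k)) at_top"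
  proof (rule tendsto_mat_powr_inverse_of_sandwich[OF Q' one _ _ K G])
    \<comment> \<open>Each of the \<open>m + 1\<close> terms of \<open>H\<close> is dominated by \<open>G p\<close>, hence so is their average.\<close>
    show "0 < 1 / real (Suc m)" by simp
    fix p :: real assume p: "0 < p"
    let ?H = "\<Sum>k\<in>{1..Suc m}. ((b k powr (1 - \<alpha>)) powr p) *\<^sub>R Q' k"
    have H_form: "x \<bullet> (?H *v x) = (\<Sum>k\<in>{1..Suc m}. (b k powr (1 - \<alpha>)) powr p * (norm (Q' k *v x))\<^sup>2)" for x
      by (rule orthogonal_projections_form[OF Q'])
    have Q'_form: "x \<bullet> (Q' k *v x) = (norm (Q' k *v x))\<^sup>2" if "k \<in> {1..Suc m}" for k x
      using Q' that by (intro orth_projection_form) (auto simp: orthogonal_projections_def)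
    show "(1 / real (Suc m)) *\<^sub>R ?H \<preceq> ?G p"
      unfolding loewner_le_def
    proof
      fix x
      have term_le: "(b k powr (1 - \<alpha>)) powr p * (norm (Q' k *v x))\<^sup>2 \<le> x \<bullet> (?G p *v x)"
        if k: "k \<in> {1..Suc m}" for k
      proof (cases "k \<le> m")
        case True
        then have k': "k \<in> {1..m}" using k by simp
        have "(b k powr p) powr (1 - \<alpha>) * (norm (Q' k *v x))\<^sup>2
            \<le> (a k powr p) powr (1 - \<alpha>) * (x \<bullet> (R k *v x))"
          using True loewner_leD[OF Q'_le[OF k], of x] Q'_form[OF k, of x]
          by (intro mult_mono) (auto simp: b_def)
        also have "\<dots> = x \<bullet> (((a k powr p) powr (1 - \<alpha>) *\<^sub>R R k) *v x)"
          by (simp add: matrix_vector_linear_simps)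
        also have "\<dots> \<le> x \<bullet> (?G p *v x)"
        proof (intro loewner_leD geo_mean_ge_projection pos_semidef_mat_powr
            pos_semidef_orth_projection E R \<alpha> A_lower k' p)
          show "R k \<preceq> E"
            using True meet_absorb(2)[OF N E, of k] by (intro orth_projection_le_of_absorb R E) (auto simp: R_def)
        qed (use a_pos[OF k'] in simp)
        finally show ?thesis by (simp only: pp)
      next
        case False
        then show ?thesis using G[of p] by (simp add: b_def pos_semidef_def)
      qed
      have "x \<bullet> (?H *v x) \<le> real (card {1..Suc m}) * (x \<bullet> (?G p *v x))"
        unfolding H_form by (rule sum_bounded_above[OF term_le])
      then show "x \<bullet> (((1 / real (Suc m)) *\<^sub>R ?H) *v x) \<le> x \<bullet> (?G p *v x)"
        by (simp only: matrix_vector_mult_scaleR_left inner_scaleR_right card_atLeastAtMost)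
          (simp add: field_simps del: sum.cl_ivl_Suc)
    qed
    show "?G p \<preceq> K *\<^sub>R ?H"
      unfolding loewner_le_def
    proof
      fix x
      let ?t = "\<lambda>k. (b k powr (1 - \<alpha>)) powr p * (norm (Q' k *v x))\<^sup>2"
      let ?M = "1 + (\<Sum>k\<in>{1..Suc m}. 2 * (C k)\<^sup>2)"
      have x: "(\<Sum>k\<in>{1..Suc m}. Q' k *v x) = x"
        unfolding matrix_vector_mult_sum_left[symmetric] one by simp
      have C_le: "2 * (C k)\<^sup>2 \<le> ?M" if "k \<in> {1..Suc m}" for k
      proof -
        have "2 * (C k)\<^sup>2 \<le> (\<Sum>k\<in>{1..Suc m}. 2 * (C k)\<^sup>2)"
          by (rule member_le_sum[OF that]) auto
        then show ?thesis by simp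
      qed
      have "x \<bullet> (?G p *v x) \<le> 2 ^ card {1..Suc m} * (\<Sum>k\<in>{1..Suc m}. (Q' k *v x) \<bullet> (?G p *v (Q' k *v x)))"
        using pos_semidef_form_sum_le[OF G, of "{1..Suc m}" "\<lambda>k. Q' k *v x" p]
        unfolding x by (simp only: finite_atLeastAtMost simp_thms)
      also have "\<dots> \<le> 2 ^ card {1..Suc m} * (\<Sum>k\<in>{1..Suc m}. ?M * ?t k)"
      proof (intro mult_left_mono sum_mono)
        fix k assume k: "k \<in> {1..Suc m}"
        have "(Q' k *v x) \<bullet> (?G p *v (Q' k *v x)) \<le> 2 * (C k)\<^sup>2 * ?t k"
          by (rule G_form[OF k p Q'_orth[OF k]])
        also have "\<dots> \<le> ?M * ?t k" by (intro mult_right_mono C_le k) simp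
        finally show "(Q' k *v x) \<bullet> (?G p *v (Q' k *v x)) \<le> ?M * ?t k" .
      qed simp
      also have "\<dots> = K * (x \<bullet> (?H *v x))"
        unfolding H_form K_def sum_distrib_left[symmetric] by simp
      finally show "x \<bullet> (?G p *v x) \<le> x \<bullet> ((K *\<^sub>R ?H) *v x)"
        by (simp only: matrix_vector_mult_scaleR_left inner_scaleR_right)
    qed
  qed simp
  then show ?thesis unfolding D .
qed

end
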